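(* Under the standing Assumption below, and with no constraint ($\mathcal{F}=2^U$), Algorithm OA (described below, unconstrained version) achieves expected profit at least $\mathrm{opt}/O(d)$, where the cost function $g$ is supermodular.
   Context: Setting: a universe $U$ of $n$ items (with $n$ known), item $e$ having value $v(e)\ge0$ and size $s(e)\in\mathbb{R}^d_{\ge0}$; items arrive in uniformly random order and must be irrevocably accepted or rejected on arrival. For $x\in[0,1]^n$, $\pi(x)=\langle v,x\rangle-g(Sx)$ where $S\in\mathbb{R}^{d\times n}$ has the sizes as columns; sets are identified with indicator vectors. $\mathrm{opt}=\max_{A\subseteq U}\pi(A)$. For $A\subseteq U$, $\mathrm{fopt}(A)=\max\{\pi(x): x\in[0,1]^n,\ x_e=0\ \forall e\notin A\}$. Standing Assumption: $g:\mathbb{R}^d_{\ge0}\to\mathbb{R}_{\ge0}$ is non-decreasing, strictly convex, closed, differentiable, $g(0)=0$, supermodular (i.e. $\nabla g$ is coordinatewise non-decreasing), and its gradients tend to $+\infty$ along every positive direction; the items are in general position (in particular for each $\lambda\in\mathbb{R}^d_{\ge0}$ at most one item $e$ has $v(e)=\langle\lambda,s(e)\rangle$); no item is exceptional, where $e$ is exceptional if $\arg\max_{\theta\in[0,1]}\{\theta v(e)-g(\theta s(e))\}\in(0,1)$; and every item has $\pi(\{e\})\le M:=\mathrm{opt}/(\eta d)$ for a constant $\eta\ge10^4$. Curve $\mathcal{C}$: let $g_i(t)=g(t\mathbf{e}_i)$ and $g_i^\star(u)=\sup_{t\ge0}(ut-g_i(t))$. For $\tau>0$ let $\lambda(\tau)$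 be the unique vector with $g^\star_i(\lambda_i(\tau))=\tau$ for all $i$. $\mathcal{C}\subseteq\mathbb{R}^d_{\ge0}$ is the union of $\{\lambda(\tau):\tau>0\}$ with a monotone curve (totally ordered by coordinatewise $\le$) from $0$ to $(g_1'(0),\dots,g_d'(0))$; $\mathcal{C}$ is totally ordered by coordinatewise order. For a set $X$ of items and $\mu\in\mathbb{R}^d_{\ge0}$, $X_\mu=\{e\in X: v(e)\ge\langle\mu,s(e)\rangle\}$. Algorithm OA: (1) let $L$ be the first $\mathrm{Binomial}(n,1/2)$ arriving items; (2) let $\mu$ be the largest vector on $\mathcal{C}$ with $\mathrm{fopt}(L_\mu)\ge\frac{1}{12d}\mathrm{fopt}(L)$; (3) let $R$ be the remaining items and $R^\circ_\mu=\{e\in R: v(e)>\langle\mu,s(e)\rangle\}$; (4) (unconstrained version) while processing $R$, accept each item of $R^\circ_\mu$ whose addition does not decrease the profit of the current accepted set, reject all other items. *)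

theory Defs
  imports "HOL-Analysis.Analysis" "HOL-Probability.Probability"
    "HOL-Combinatorics.Multiset_Permutations"
begin

text \<open>
  The constant hidden in $O(d)$ must not depend on the dimension, so the dimension is a natural
  number rather than a type: a vector of $\mathbb{R}^d$ is a function on \<^typ>\<open>nat\<close> that vanishes
  outside \<open>{..<d}\<close>. On such functions the library order on \<^typ>\<open>nat \<Rightarrow> real\<close> is the coordinatewise
  order, and its product topology induces the Euclidean topology. Likewise the universe of items
  is \<open>{..<n}\<close>.
\<close>

type_synonym rvec = "nat \<Rightarrow> real"

definition vecs :: "nat \<Rightarrow> rvec set" where
  "vecs d = {x. \<forall>i\<ge>d. x i = 0}"

definition orthant :: "nat \<Rightarrow> rvec set" where
  "orthant d = {x \<in> vecs d. \<forall>i<d. 0 \<le> x i}"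

definition dot :: "nat \<Rightarrow> rvec \<Rightarrow> rvec \<Rightarrow> real" where
  "dot d x y = (\<Sum>i<d. x i * y i)"

definition axis_vec :: "nat \<Rightarrow> real \<Rightarrow> rvec" where
  "axis_vec i t = (\<lambda>j. if j = i then t else 0)"


section \<open>Cost functions on the nonnegative orthant\<close>

definition strictly_convex_on_orthant :: "nat \<Rightarrow> (rvec \<Rightarrow> real) \<Rightarrow> bool" where
  "strictly_convex_on_orthant d g \<longleftrightarrow>
     (\<forall>x\<in>orthant d. \<forall>y\<in>orthant d. \<forall>t. x \<noteq> y \<longrightarrow> 0 < t \<longrightarrow> t < 1 \<longrightarrow>
        g (\<lambda>i. (1 - t) * x i + t * y i) < (1 - t) * g x + t * g y)"

text \<open>
  Frechet differentiability relative to the orthant (one-sided on its boundary), written out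
  because \<^typ>\<open>nat \<Rightarrow> real\<close> is not a normed space.
\<close>

definition has_gradient :: "nat \<Rightarrow> (rvec \<Rightarrow> real) \<Rightarrow> rvec \<Rightarrow> rvec \<Rightarrow> bool" where
  "has_gradient d g D x \<longleftrightarrow> D \<in> vecs d \<and>
     ((\<lambda>y. (g y - g x - dot d D (\<lambda>i. y i - x i)) / L2_set (\<lambda>i. y i - x i) {..<d})
        \<longlongrightarrow> 0) (at x within orthant d)"

definition grad :: "nat \<Rightarrow> (rvec \<Rightarrow> real) \<Rightarrow> rvec \<Rightarrow> rvec" where
  "grad d g x = (THE D. has_gradient d g D x)"

text \<open>
  In the last clause, directions \<open>u\<close> on the boundary of the orthant (such as coordinate axes) count
  as positive, and the gradient tends to infinity along \<open>u\<close> in the sense of the directional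
  derivative; this is what makes all conjugates \<open>gi_star\<close> below finite.
\<close>

definition admissible_cost :: "nat \<Rightarrow> (rvec \<Rightarrow> real) \<Rightarrow> bool" where
  "admissible_cost d g \<longleftrightarrow>
     (\<forall>x\<in>orthant d. 0 \<le> g x) \<and>
     g (\<lambda>_. 0) = 0 \<and>
     mono_on (orthant d) g \<and>
     strictly_convex_on_orthant d g \<and>
     closed (epigraph (orthant d) g) \<and>
     (\<forall>x\<in>orthant d. \<exists>D. has_gradient d g D x) \<and>
     mono_on (orthant d) (grad d g) \<and>
     (\<forall>u\<in>orthant d. u \<noteq> (\<lambda>_. 0) \<longrightarrow>
        filterlim (\<lambda>t. dot d (grad d g (\<lambda>i. t * u i)) u) at_top at_top)"


section \<open>The profit maximization problem\<close>

text \<open>The vector $Sx$, where the sizes are the columns of $S$.\<close>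

definition load :: "nat \<Rightarrow> (nat \<Rightarrow> rvec) \<Rightarrow> (nat \<Rightarrow> real) \<Rightarrow> rvec" where
  "load n s x = (\<lambda>i. \<Sum>e<n. s e i * x e)"

definition profit ::
    "nat \<Rightarrow> (nat \<Rightarrow> real) \<Rightarrow> (nat \<Rightarrow> rvec) \<Rightarrow> (rvec \<Rightarrow> real) \<Rightarrow> (nat \<Rightarrow> real) \<Rightarrow> real" where
  "profit n v s g x = (\<Sum>e<n. v e * x e) - g (load n s x)"

abbreviation set_profit ::
    "nat \<Rightarrow> (nat \<Rightarrow> real) \<Rightarrow> (nat \<Rightarrow> rvec) \<Rightarrow> (rvec \<Rightarrow> real) \<Rightarrow> nat set \<Rightarrow> real" where
  "set_profit n v s g A \<equiv> profit n v s g (indicator A)"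

definition opt :: "nat \<Rightarrow> (nat \<Rightarrow> real) \<Rightarrow> (nat \<Rightarrow> rvec) \<Rightarrow> (rvec \<Rightarrow> real) \<Rightarrow> real" where
  "opt n v s g = Max (set_profit n v s g ` Pow {..<n})"

text \<open>For \<open>A \<subseteq> {..<n}\<close> and admissible \<open>g\<close> the following supremum is attained.\<close>

definition fopt ::
    "nat \<Rightarrow> (nat \<Rightarrow> real) \<Rightarrow> (nat \<Rightarrow> rvec) \<Rightarrow> (rvec \<Rightarrow> real) \<Rightarrow> nat set \<Rightarrow> real" where
  "fopt n v s g A =
     (SUP x\<in>{x. (\<forall>e. x e \<in> {0..1}) \<and> (\<forall>e. e \<notin> A \<longrightarrow> x e = 0)}. profit n v s g x)"

definition exceptional :: "real \<Rightarrow> rvec \<Rightarrow> (rvec \<Rightarrow> real) \<Rightarrow> bool" where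
  "exceptional ve se g \<longleftrightarrow>
     {\<theta>. is_arg_max (\<lambda>\<theta>. \<theta> * ve - g (\<lambda>i. \<theta> * se i)) (\<lambda>\<theta>. \<theta> \<in> {0..1}) \<theta>} \<subseteq> {0<..<1::real}"

definition general_position :: "nat \<Rightarrow> nat \<Rightarrow> (nat \<Rightarrow> real) \<Rightarrow> (nat \<Rightarrow> rvec) \<Rightarrow> bool" where
  "general_position d n v s \<longleftrightarrow>
     (\<forall>l\<in>orthant d. \<forall>e<n. \<forall>e'<n. v e = dot d l (s e) \<longrightarrow> v e' = dot d l (s e') \<longrightarrow> e = e')"

definition standing_assumption ::
    "nat \<Rightarrow> nat \<Rightarrow> (nat \<Rightarrow> real) \<Rightarrow> (nat \<Rightarrow> rvec) \<Rightarrow> (rvec \<Rightarrow> real) \<Rightarrow> real \<Rightarrow> bool" where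
  "standing_assumption d n v s g \<eta> \<longleftrightarrow>
     admissible_cost d g \<and>
     (\<forall>e<n. 0 \<le> v e \<and> s e \<in> orthant d) \<and>
     general_position d n v s \<and>
     (\<forall>e<n. \<not> exceptional (v e) (s e) g) \<and>
     \<eta> \<ge> 10 ^ 4 \<and>
     (\<forall>e<n. set_profit n v s g {e} \<le> opt n v s g / (\<eta> * real d))"


section \<open>The curve of thresholds\<close>

definition gi_star :: "(rvec \<Rightarrow> real) \<Rightarrow> nat \<Rightarrow> real \<Rightarrow> real" where
  "gi_star g i u = (SUP t\<in>{0..}. u * t - g (axis_vec i t))"

definition curve_point :: "nat \<Rightarrow> (rvec \<Rightarrow> real) \<Rightarrow> real \<Rightarrow> rvec" where
  "curve_point d g \<tau> = (THE l. l \<in> vecs d \<and> (\<forall>i<d. gi_star g i (l i) = \<tau>))"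

text \<open>The vector of the one-sided derivatives $g_i'(0)$.\<close>

definition axis_slopes :: "nat \<Rightarrow> (rvec \<Rightarrow> real) \<Rightarrow> rvec" where
  "axis_slopes d g = (\<lambda>i. if i < d
     then vector_derivative (\<lambda>t. g (axis_vec i t)) (at 0 within {0..}) else 0)"

definition threshold_curve :: "nat \<Rightarrow> (rvec \<Rightarrow> real) \<Rightarrow> rvec set \<Rightarrow> bool" where
  "threshold_curve d g \<C> \<longleftrightarrow>
     (\<exists>\<gamma>. path \<gamma> \<and> mono_on {0..1} \<gamma> \<and>
        pathstart \<gamma> = (\<lambda>_. 0) \<and> pathfinish \<gamma> = axis_slopes d g \<and>
        \<C> = curve_point d g ` {0<..} \<union> path_image \<gamma>)"


section \<open>Algorithm OA, unconstrained version\<close>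

definition items_above ::
    "nat \<Rightarrow> (nat \<Rightarrow> real) \<Rightarrow> (nat \<Rightarrow> rvec) \<Rightarrow> nat set \<Rightarrow> rvec \<Rightarrow> nat set" where
  "items_above d v s X \<mu> = {e \<in> X. v e \<ge> dot d \<mu> (s e)}"

definition items_strictly_above ::
    "nat \<Rightarrow> (nat \<Rightarrow> real) \<Rightarrow> (nat \<Rightarrow> rvec) \<Rightarrow> nat set \<Rightarrow> rvec \<Rightarrow> nat set" where
  "items_strictly_above d v s X \<mu> = {e \<in> X. v e > dot d \<mu> (s e)}"

definition largest_threshold ::
    "nat \<Rightarrow> nat \<Rightarrow> (nat \<Rightarrow> real) \<Rightarrow> (nat \<Rightarrow> rvec) \<Rightarrow> (rvec \<Rightarrow> real) \<Rightarrow> rvec set \<Rightarrow>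
     nat set \<Rightarrow> rvec \<Rightarrow> bool" where
  "largest_threshold d n v s g \<C> L \<mu> \<longleftrightarrow>
     (let good = {\<mu>\<in>\<C>. fopt n v s g (items_above d v s L \<mu>) \<ge> 1 / (12 * real d) * fopt n v s g L}
      in \<mu> \<in> good \<and> (\<forall>\<mu>'\<in>good. \<mu>' \<le> \<mu>))"

text \<open>
  A rule \<open>m\<close> that turns the sample \<open>L\<close> into the threshold \<open>\<mu>\<close>. A largest threshold fails to exist
  only if all of \<open>\<C>\<close> qualifies (for example \<open>fopt L = 0\<close>, as for an empty sample); the
  algorithm may then use any vector.
\<close>

definition threshold_rule ::
    "nat \<Rightarrow> nat \<Rightarrow> (nat \<Rightarrow> real) \<Rightarrow> (nat \<Rightarrow> rvec) \<Rightarrow> (rvec \<Rightarrow> real) \<Rightarrow> rvec set \<Rightarrow>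
     (nat set \<Rightarrow> rvec) \<Rightarrow> bool" where
  "threshold_rule d n v s g \<C> m \<longleftrightarrow>
     (\<forall>L\<subseteq>{..<n}. (\<exists>\<mu>. largest_threshold d n v s g \<C> L \<mu>)
        \<longrightarrow> largest_threshold d n v s g \<C> L (m L))"

definition process ::
    "nat \<Rightarrow> (nat \<Rightarrow> real) \<Rightarrow> (nat \<Rightarrow> rvec) \<Rightarrow> (rvec \<Rightarrow> real) \<Rightarrow> nat set \<Rightarrow> nat list \<Rightarrow> nat set" where
  "process n v s g X es =
     fold (\<lambda>e A. if e \<in> X \<and> set_profit n v s g (insert e A) \<ge> set_profit n v s g A
                 then insert e A else A) es {}"

text \<open>The set accepted when the items arrive in the order \<open>es\<close> and the sample has size \<open>k\<close>.\<close>

definition OA ::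
    "nat \<Rightarrow> nat \<Rightarrow> (nat \<Rightarrow> real) \<Rightarrow> (nat \<Rightarrow> rvec) \<Rightarrow> (rvec \<Rightarrow> real) \<Rightarrow> (nat set \<Rightarrow> rvec) \<Rightarrow>
     nat \<Rightarrow> nat list \<Rightarrow> nat set" where
  "OA d n v s g m k es =
     (let L = set (take k es); \<mu> = m L; R = drop k es
      in process n v s g (items_strictly_above d v s (set R) \<mu>) R)"

definition arrivals :: "nat \<Rightarrow> (nat \<times> nat list) pmf" where
  "arrivals n = pair_pmf (binomial_pmf n (1/2)) (pmf_of_set (permutations_of_set {..<n}))"

definition expected_profit ::
    "nat \<Rightarrow> nat \<Rightarrow> (nat \<Rightarrow> real) \<Rightarrow> (nat \<Rightarrow> rvec) \<Rightarrow> (rvec \<Rightarrow> real) \<Rightarrow> (nat set \<Rightarrow> rvec) \<Rightarrow> real" where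
  "expected_profit d n v s g m =
     measure_pmf.expectation (arrivals n) (\<lambda>(k, es). set_profit n v s g (OA d n v s g m k es))"

end

theory Submission
  imports Defs
begin

text \<open>
  For a threshold \<open>\<mu>\<close> on the curve with common conjugate value \<open>\<tau>\<close>, supermodularity gives
  \<open>g y \<ge> \<Sum>\<^sub>i g\<^sub>i (y\<^sub>i)\<close>, so items below \<open>\<mu>\<close> contribute a fractional profit of at most \<open>d \<tau>\<close>. Since \<open>\<mu>\<close> is
  the largest threshold whose sampled items still carry a \<open>1/(12 d)\<close> fraction of \<open>fopt L\<close>, this forces
  \<open>\<tau>\<close> to be of order \<open>fopt L / d\<close>. While the gradient at the current load is at most \<open>\<mu>\<close>, greedy
  accepts every item above \<open>\<mu>\<close>. If the gradient ever leaves the box below \<open>\<mu>\<close>, concavity shows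
  that the profit has reached \<open>\<tau>\<close>, up to one item. Otherwise the accepted set consists of all
  items of \<open>R\<close> above \<open>\<mu>\<close> and is fractionally optimal for them.

  No uniform concentration over thresholds is needed: the sets of items above points of the curve
  form a chain, and its smallest member \<open>W\<close> with large \<open>fopt\<close> is deterministic and lies above \<open>\<mu>\<close>. So
  it suffices that \<open>fopt L\<close> and \<open>fopt (R \<inter> W)\<close> are large, which holds with probability at least \<open>1/2\<close>
  by Chebyshev's inequality, because submodularity of the profit gives additive lower bounds
  whose coefficients are capped by the profits of single items.
\<close>

section \<open>Supermodular cost functions\<close>

text \<open>Along the line the increment has norm \<open>\<bar>t - t0\<bar> * N\<close>, so the
  Frechet quotient times \<open>N\<close> is, up to sign, the error of the difference quotient.
  Restricting to parameters that stay in the orthant covers one-sided derivatives at its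
  boundary.\<close>

lemma has_gradient_along_line:
  assumes D: "has_gradient d g D (\<lambda>i. x i + t0 * w i)" and w: "w \<in> vecs d"
  shows "((\<lambda>t. g (\<lambda>i. x i + t * w i)) has_real_derivative dot d D w)
           (at t0 within {t. (\<lambda>i. x i + t * w i) \<in> orthant d})"
proof (cases "w = (\<lambda>_. 0)")
  case True
  then show ?thesis by (simp add: dot_def)
next
  case False
  define p where "p t = (\<lambda>i. x i + t * w i)" for t
  define N where "N = L2_set w {..<d}"
  define T where "T = {t. p t \<in> orthant d}"
  from False obtain j where j: "w j \<noteq> 0" by auto
  then have "j < d" using w by (force simp: vecs_def not_less[symmetric])
  then have N: "N > 0"
    using j by (metis N_def L2_set_eq_0_iff L2_set_nonneg finite_lessThan less_eq_real_def lessThan_iff)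
  have neq: "p t \<noteq> p t0" if "t \<noteq> t0" for t
    using that j by (auto simp: p_def fun_eq_iff)
  have "continuous_on UNIV p"
    unfolding p_def by (intro continuous_on_coordinatewise_then_product continuous_intros)
  then have "(p \<longlongrightarrow> p t0) (at t0 within T)"
    by (meson UNIV_I continuous_on_def tendsto_within_subset top_greatest)
  then have lim: "filterlim p (at (p t0) within orthant d) (at t0 within T)"
    unfolding filterlim_at by (auto simp: eventually_at_filter T_def neq)
  have "((\<lambda>y. (g y - g (p t0) - dot d D (\<lambda>i. y i - p t0 i)) / L2_set (\<lambda>i. y i - p t0 i) {..<d})
        \<longlongrightarrow> 0) (at (p t0) within orthant d)"
    using D by (simp add: has_gradient_def p_def)
  from tendsto_mult_left[OF tendsto_rabs_zero[OF filterlim_compose[OF this lim]], of N]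
  have "((\<lambda>t. N * \<bar>(g (p t) - g (p t0) - dot d D (\<lambda>i. p t i - p t0 i)) / L2_set (\<lambda>i. p t i - p t0 i) {..<d}\<bar>)
        \<longlongrightarrow> 0) (at t0 within T)" by simp
  moreover have "\<forall>\<^sub>F t in at t0 within T. N * \<bar>(g (p t) - g (p t0) - dot d D (\<lambda>i. p t i - p t0 i)) / L2_set (\<lambda>i. p t i - p t0 i) {..<d}\<bar>
     = \<bar>(g (p t) - g (p t0)) / (t - t0) - dot d D w\<bar>"
    unfolding eventually_at_filter
  proof (intro always_eventually allI impI)
    fix t assume t: "t \<noteq> t0"
    have 1: "(\<lambda>i. p t i - p t0 i) = (\<lambda>i. (t - t0) * w i)"
      by (auto simp: p_def algebra_simps)
    have 2: "dot d D (\<lambda>i. (t - t0) * w i) = (t - t0) * dot d D w"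
      by (simp add: dot_def sum_distrib_left algebra_simps)
    have 3: "L2_set (\<lambda>i. (t - t0) * w i) {..<d} = \<bar>t - t0\<bar> * N"
      unfolding N_def L2_set_def
      by (simp add: power_mult_distrib flip: sum_distrib_left) (simp add: real_sqrt_mult)
    have "(g (p t) - g (p t0)) / (t - t0) - dot d D w
        = (g (p t) - g (p t0) - (t - t0) * dot d D w) / (t - t0)"
      using t by (simp add: field_simps)
    then show "N * \<bar>(g (p t) - g (p t0) - dot d D (\<lambda>i. p t i - p t0 i)) / L2_set (\<lambda>i. p t i - p t0 i) {..<d}\<bar>
     = \<bar>(g (p t) - g (p t0)) / (t - t0) - dot d D w\<bar>"
      unfolding 1 2 3 using N by (simp add: abs_mult abs_divide)
  qed
  ultimately have "((\<lambda>t. \<bar>(g (p t) - g (p t0)) / (t - t0) - dot d D w\<bar>) \<longlongrightarrow> 0) (at t0 within T)"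
    by (rule Lim_transform_eventually)
  then have "((\<lambda>t. (g (p t) - g (p t0)) / (t - t0)) \<longlongrightarrow> dot d D w) (at t0 within T)"
    using tendsto_rabs_zero_iff LIM_zero_cancel by fast
  then show ?thesis by (simp add: has_field_derivative_iff p_def T_def)
qed

section \<open>Inner products and the orthant\<close>

lemma dot_add_right: "dot d x (\<lambda>i. y i + z i) = dot d x y + dot d x z"
  by (simp add: dot_def algebra_simps sum.distrib)

lemma dot_diff_right: "dot d x (\<lambda>i. y i - z i) = dot d x y - dot d x z"
  by (simp add: dot_def algebra_simps sum_subtractf)

lemma dot_scale_right: "dot d x (\<lambda>i. c * y i) = c * dot d x y"
  by (simp add: dot_def algebra_simps sum_distrib_left)

lemma dot_minus_right: "dot d x (\<lambda>i. - y i) = - dot d x y"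
  by (simp add: dot_def sum_negf)

lemma dot_axis_vec: "i < d \<Longrightarrow> dot d x (axis_vec i t) = x i * t"
  by (simp add: dot_def axis_vec_def if_distrib sum.delta cong: if_cong)

lemma dot_mono_left:
  assumes "\<And>i. i < d \<Longrightarrow> x i \<le> x' i" and "y \<in> orthant d"
  shows "dot d x y \<le> dot d x' y"
  unfolding dot_def using assms by (intro sum_mono mult_right_mono) (auto simp: orthant_def)

lemma zero_in_orthant: "(\<lambda>_. 0) \<in> orthant d"
  by (simp add: orthant_def vecs_def)

lemma axis_vec_in_orthant: "i < d \<Longrightarrow> 0 \<le> t \<Longrightarrow> axis_vec i t \<in> orthant d"
  by (auto simp: orthant_def vecs_def axis_vec_def)

lemma orthant_add: "x \<in> orthant d \<Longrightarrow> y \<in> orthant d \<Longrightarrow> (\<lambda>i. x i + y i) \<in> orthant d"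
  by (auto simp: orthant_def vecs_def)

lemma orthant_scale: "x \<in> orthant d \<Longrightarrow> 0 \<le> c \<Longrightarrow> (\<lambda>i. c * x i) \<in> orthant d"
  by (auto simp: orthant_def vecs_def)

lemma orthant_nonneg: "x \<in> orthant d \<Longrightarrow> 0 \<le> x i"
  by (cases "i < d") (auto simp: orthant_def vecs_def)

lemma orthant_le: "x \<in> orthant d \<Longrightarrow> (\<And>i. i < d \<Longrightarrow> x i \<le> y i) \<Longrightarrow> y \<in> vecs d \<Longrightarrow> x \<le> y"
  by (auto simp: orthant_def vecs_def le_fun_def) (metis leI order_refl)

section \<open>First-order calculus of the cost function\<close>

locale cost_function =
  fixes d :: nat and g :: "rvec \<Rightarrow> real"
  assumes admissible: "admissible_cost d g"
begin

lemma g_nonneg: "x \<in> orthant d \<Longrightarrow> 0 \<le> g x"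
  using admissible by (simp add: admissible_cost_def)

lemma g_zero [simp]: "g (\<lambda>_. 0) = 0"
  using admissible by (simp add: admissible_cost_def)

lemma g_convex:
  assumes "x \<in> orthant d" "y \<in> orthant d" "0 \<le> t" "t \<le> 1"
  shows "g (\<lambda>i. (1 - t) * x i + t * y i) \<le> (1 - t) * g x + t * g y"
proof (cases "x = y \<or> t = 0 \<or> t = 1")
  case True
  then show ?thesis by (auto simp: algebra_simps)
next
  case False
  then have "0 < t" "t < 1" "x \<noteq> y" using assms by auto
  then show ?thesis
    using admissible assms
    unfolding admissible_cost_def strictly_convex_on_orthant_def
    by (meson less_imp_le)
qed

text \<open>From every point of the orthant one can step in each positive axis direction, and the
  right derivatives there are the coordinates of the gradient. This makes the definite description
  \<open>grad\<close> denote.\<close>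

lemma has_gradient_unique:
  assumes "has_gradient d g D x" "has_gradient d g D' x" "x \<in> orthant d"
  shows "D = D'"
proof
  fix i
  show "D i = D' i"
  proof (cases "i < d")
    case False
    then show ?thesis using assms by (auto simp: has_gradient_def vecs_def)
  next
    case True
    let ?T = "{t. (\<lambda>j. x j + t * axis_vec i 1 j) \<in> orthant d}"
    have ax: "axis_vec i 1 \<in> vecs d" using True by (auto simp: vecs_def axis_vec_def)
    have sub: "{0<..} \<subseteq> ?T" using assms(3) True by (auto simp: orthant_def vecs_def axis_vec_def)
    have *: "((\<lambda>t. (g (\<lambda>j. x j + t * axis_vec i 1 j) - g x) / t) \<longlongrightarrow> E i) (at_right 0)"
      if "has_gradient d g E x" for E
    proof -
      have "((\<lambda>t. g (\<lambda>j. x j + t * axis_vec i 1 j)) has_real_derivative dot d E (axis_vec i 1)) (at 0 within ?T)"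
        by (rule has_gradient_along_line) (use that ax in auto)
      then have "((\<lambda>t. g (\<lambda>j. x j + t * axis_vec i 1 j)) has_real_derivative dot d E (axis_vec i 1)) (at_right 0)"
        by (rule has_field_derivative_subset) (use sub in auto)
      then show ?thesis using True by (simp add: has_field_derivative_iff dot_axis_vec)
    qed
    from *[OF assms(1)] *[OF assms(2)] show ?thesis
      using tendsto_unique trivial_limit_at_right_real by blast
  qed
qed

lemma has_gradient_grad:
  assumes "x \<in> orthant d"
  shows "has_gradient d g (grad d g x) x"
proof -
  obtain D where D: "has_gradient d g D x"
    using assms admissible unfolding admissible_cost_def by metis
  show ?thesis
    unfolding grad_def
    by (rule theI[where a = D]) (use D has_gradient_unique assms in auto)
qed

lemma grad_mono: "x \<in> orthant d \<Longrightarrow> y \<in> orthant d \<Longrightarrow> x \<le> y \<Longrightarrow> grad d g x \<le> grad d g y"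
  using admissible by (auto simp: admissible_cost_def mono_on_def)

lemma g_along_line:
  assumes "(\<lambda>i. x i + t0 * w i) \<in> orthant d" "w \<in> vecs d"
  shows "((\<lambda>t. g (\<lambda>i. x i + t * w i)) has_real_derivative
           dot d (grad d g (\<lambda>i. x i + t0 * w i)) w)
           (at t0 within {t. (\<lambda>i. x i + t * w i) \<in> orthant d})"
  by (rule has_gradient_along_line) (use assms has_gradient_grad in auto)

lemma segment_in_orthant:
  assumes "x \<in> orthant d" "(\<lambda>i. x i + u i) \<in> orthant d" "0 \<le> t" "t \<le> 1"
  shows "(\<lambda>i. x i + t * u i) \<in> orthant d"
proof -
  have "(\<lambda>i. (1 - t) * x i + t * (x i + u i)) \<in> orthant d"
    by (intro orthant_add orthant_scale assms) (use assms in auto)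
  then show ?thesis by (simp add: algebra_simps)
qed

text \<open>Convexity of the orthant keeps the segment from \<open>x\<close> to \<open>x + u\<close>
  inside it, so the right-hand limit makes sense even for \<open>x\<close> on the boundary.\<close>

lemma directional_derivative:
  assumes "x \<in> orthant d" "(\<lambda>i. x i + u i) \<in> orthant d"
  shows "((\<lambda>t. (g (\<lambda>i. x i + t * u i) - g x) / t) \<longlongrightarrow> dot d (grad d g x) u) (at 0 within {0<..1})"
proof -
  have "u \<in> vecs d" using assms by (auto simp: orthant_def vecs_def)
  then have "((\<lambda>t. g (\<lambda>i. x i + t * u i)) has_real_derivative dot d (grad d g (\<lambda>i. x i + 0 * u i)) u)
      (at 0 within {t. (\<lambda>i. x i + t * u i) \<in> orthant d})"
    by (intro g_along_line) (use assms in auto)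
  then have "((\<lambda>t. g (\<lambda>i. x i + t * u i)) has_real_derivative dot d (grad d g (\<lambda>i. x i + 0 * u i)) u)
      (at 0 within {0<..1})"
    by (rule has_field_derivative_subset) (use segment_in_orthant[OF assms] in auto)
  then show ?thesis by (simp add: has_field_derivative_iff)
qed

lemma nontrivial_at_0: "at 0 within {0<..1::real} \<noteq> bot"
  by (simp add: trivial_limit_within islimpt_in_closure)

lemma directional_derivative_ge:
  assumes "x \<in> orthant d" "(\<lambda>i. x i + u i) \<in> orthant d"
    and "\<And>t. 0 < t \<Longrightarrow> t \<le> 1 \<Longrightarrow> g x + t * c \<le> g (\<lambda>i. x i + t * u i)"
  shows "c \<le> dot d (grad d g x) u"
proof (rule tendsto_lowerbound[OF directional_derivative[OF assms(1,2)] _ nontrivial_at_0])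
  have "c \<le> (g (\<lambda>i. x i + t * u i) - g x) / t" if "0 < t" "t \<le> 1" for t
    using assms(3)[OF that] that by (simp add: field_simps)
  then show "\<forall>\<^sub>F t in at 0 within {0<..1}. c \<le> (g (\<lambda>i. x i + t * u i) - g x) / t"
    by (simp add: eventually_at_filter)
qed

lemma gradient_inequality:
  assumes "x \<in> orthant d" "y \<in> orthant d"
  shows "g x + dot d (grad d g x) (\<lambda>i. y i - x i) \<le> g y"
proof -
  have "dot d (grad d g x) (\<lambda>i. y i - x i) \<le> g y - g x"
  proof (rule tendsto_upperbound[OF directional_derivative[OF assms(1)] _ nontrivial_at_0])
    show "(\<lambda>i. x i + (y i - x i)) \<in> orthant d" using assms by simp
    have "(g (\<lambda>i. x i + t * (y i - x i)) - g x) / t \<le> g y - g x" if "0 < t" "t \<le> 1" for t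
    proof -
      have "g (\<lambda>i. (1 - t) * x i + t * y i) \<le> (1 - t) * g x + t * g y"
        using that by (intro g_convex assms) auto
      also have "(\<lambda>i. (1 - t) * x i + t * y i) = (\<lambda>i. x i + t * (y i - x i))"
        by (auto simp: algebra_simps)
      finally show ?thesis using that by (simp add: field_simps)
    qed
    then show "\<forall>\<^sub>F t in at 0 within {0<..1}. (g (\<lambda>i. x i + t * (y i - x i)) - g x) / t \<le> g y - g x"
      by (simp add: eventually_at_filter)
  qed
  then show ?thesis by simp
qed

lemma continuous_on_g_line:
  assumes "a \<in> orthant d" "b \<in> orthant d"
  shows "continuous_on {0..} (\<lambda>t. g (\<lambda>i. a i + t * b i))"
proof -
  let ?T = "{t. (\<lambda>i. a i + t * b i) \<in> orthant d}"
  have "continuous_on ?T (\<lambda>t. g (\<lambda>i. a i + t * b i))"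
    by (rule DERIV_continuous_on, rule g_along_line) (use assms in \<open>auto simp: orthant_def\<close>)
  then show ?thesis
    by (rule continuous_on_subset) (use assms in \<open>auto intro!: orthant_add orthant_scale\<close>)
qed

text \<open>Adding \<open>b\<close> can only raise the slope along \<open>c\<close>, so
  \<open>?h\<close> is nondecreasing. At interior parameters the derivatives are two-sided; the end
  points enter by continuity.\<close>

lemma g_supermodular:
  assumes a: "a \<in> orthant d" and b: "b \<in> orthant d" and c: "c \<in> orthant d"
  shows "g (\<lambda>i. a i + c i) - g a \<le> g (\<lambda>i. a i + b i + c i) - g (\<lambda>i. a i + b i)"
proof -
  let ?h = "\<lambda>t. g (\<lambda>i. a i + b i + t * c i) - g (\<lambda>i. a i + t * c i)"
  note ab = orthant_add[OF a b]
  have deriv: "((\<lambda>t. g (\<lambda>i. x i + t * c i)) has_real_derivative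
           dot d (grad d g (\<lambda>i. x i + t * c i)) c) (at t)"
    if "0 < t" "x \<in> orthant d" for x t
  proof -
    have in_orthant: "(\<lambda>i. x i + r * c i) \<in> orthant d" if "0 < r" for r
      using that \<open>x \<in> orthant d\<close> c by (auto intro!: orthant_add orthant_scale)
    then have "((\<lambda>t. g (\<lambda>i. x i + t * c i)) has_real_derivative
           dot d (grad d g (\<lambda>i. x i + t * c i)) c) (at t within {0<..})"
      using that c
      by (intro has_field_derivative_subset[OF g_along_line]) (auto simp: orthant_def)
    then show ?thesis using that by (simp add: at_within_open[of t "{0<..}"])
  qed
  have "?h 0 \<le> ?h 1"
  proof (rule DERIV_nonneg_imp_increasing_open[where f = ?h and a = 0 and b = 1])
    show "continuous_on {0..1} ?h"
      by (intro continuous_on_diff continuous_on_subset[OF continuous_on_g_line[OF ab c]]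
          continuous_on_subset[OF continuous_on_g_line[OF a c]]) auto
    fix t :: real assume t: "0 < t" "t < 1"
    let ?D = "dot d (grad d g (\<lambda>i. a i + b i + t * c i)) c - dot d (grad d g (\<lambda>i. a i + t * c i)) c"
    have "(?h has_real_derivative ?D) (at t)"
      by (intro DERIV_diff deriv t a ab)
    moreover have "grad d g (\<lambda>i. a i + t * c i) \<le> grad d g (\<lambda>i. a i + b i + t * c i)"
      using t b c a by (intro grad_mono orthant_add orthant_scale) (auto simp: le_fun_def orthant_nonneg)
    then have "0 \<le> ?D"
      using dot_mono_left[OF _ c] by (simp add: le_fun_def)
    ultimately show "\<exists>y. (?h has_real_derivative y) (at t) \<and> 0 \<le> y" by blast
  qed simp
  then show ?thesis by simp
qed

lemma g_superadditive:
  assumes "x \<in> orthant d" "y \<in> orthant d"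
  shows "g x + g y \<le> g (\<lambda>i. x i + y i)"
  using g_supermodular[OF zero_in_orthant assms] by simp

text \<open>Superadditivity splits off one axis component at a time.\<close>

lemma sum_axes_le_g:
  assumes x: "x \<in> orthant d"
  shows "(\<Sum>i<d. g (axis_vec i (x i))) \<le> g x"
proof -
  have "(\<Sum>i<k. g (axis_vec i (x i))) \<le> g (\<lambda>j. if j < k then x j else 0)" if "k \<le> d" for k
    using that
  proof (induction k)
    case (Suc k)
    let ?b = "\<lambda>j. if j < k then x j else 0"
    have "?b \<in> orthant d" using x by (auto simp: orthant_def vecs_def)
    moreover have "axis_vec k (x k) \<in> orthant d"
      using Suc x by (intro axis_vec_in_orthant) (auto simp: orthant_def)
    ultimately have "g ?b + g (axis_vec k (x k)) \<le> g (\<lambda>j. ?b j + axis_vec k (x k) j)"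
      by (rule g_superadditive)
    also have "(\<lambda>j. ?b j + axis_vec k (x k) j) = (\<lambda>j. if j < Suc k then x j else 0)"
      by (auto simp: axis_vec_def)
    finally show ?case using Suc by simp
  qed simp
  from this[of d] have "(\<Sum>i<d. g (axis_vec i (x i))) \<le> g (\<lambda>j. if j < d then x j else 0)" by simp
  also have "(\<lambda>j. if j < d then x j else 0) = x" using x by (auto simp: orthant_def vecs_def)
  finally show ?thesis .
qed

section \<open>Leaving the region where the gradient is at most \<open>\<mu>\<close>\<close>

lemma gi_star_least:
  assumes "\<And>t. 0 \<le> t \<Longrightarrow> u * t - g (axis_vec i t) \<le> c"
  shows "gi_star g i u \<le> c"
  unfolding gi_star_def using assms by (intro cSUP_least) auto

text \<open>
  Along the segment from \<open>a\<close> to \<open>a + b\<close> let \<open>w\<close> be the last point before which the gradient is at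
  most \<open>\<mu>\<close>. At \<open>w\<close> the concave function \<open>\<mu>\<cdot>y - g y\<close> increases neither in direction \<open>- w\<close> nor along
  some axis \<open>i\<close>, so \<open>w\<close> is at least as good as every point of that axis. The gradient of \<open>g\<close> may
  jump at \<open>w\<close> when \<open>w\<close> lies on the boundary of the orthant, hence the one-sided limits.
\<close>

lemma gradient_crossing:
  assumes a: "a \<in> orthant d" and b: "b \<in> orthant d"
    and below: "\<And>i. i < d \<Longrightarrow> grad d g a i \<le> \<mu> i"
    and above: "k < d" "\<mu> k < grad d g (\<lambda>i. a i + b i) k"
  obtains \<theta> i where "0 \<le> \<theta>" "\<theta> \<le> 1" "i < d"
    "gi_star g i (\<mu> i) \<le> dot d \<mu> (\<lambda>i. a i + \<theta> * b i) - g (\<lambda>i. a i + \<theta> * b i)"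
proof -
  define z where "z \<theta> = (\<lambda>i. a i + \<theta> * b i)" for \<theta>
  have z: "z \<theta> \<in> orthant d" if "0 \<le> \<theta>" for \<theta>
    using a b that unfolding z_def by (intro orthant_add orthant_scale)
  have zmono: "grad d g (z \<theta>) i \<le> grad d g (z \<theta>') i" if "0 \<le> \<theta>" "\<theta> \<le> \<theta>'" for \<theta> \<theta>' i
  proof -
    have "z \<theta> \<le> z \<theta>'"
    proof (rule orthant_le[OF z[OF that(1)]])
      show "z \<theta> i \<le> z \<theta>' i" if "i < d" for i
        using \<open>\<theta> \<le> \<theta>'\<close> b that by (auto simp: z_def orthant_def intro!: mult_right_mono)
      show "z \<theta>' \<in> vecs d" using z[of \<theta>'] that by (auto simp: orthant_def)
    qed
    then have "grad d g (z \<theta>) \<le> grad d g (z \<theta>')"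
      using z that by (intro grad_mono) auto
    then show ?thesis by (simp add: le_fun_def)
  qed
  define S where "S = {\<theta>\<in>{0..1}. \<forall>i<d. grad d g (z \<theta>) i \<le> \<mu> i}"
  have S0: "0 \<in> S" using below by (simp add: S_def z_def)
  have S1: "1 \<notin> S" using above by (auto simp: S_def z_def not_le)
  have bdd: "bdd_above S" by (auto simp: S_def)
  \<comment> \<open>Monotonicity of the gradient makes \<open>S\<close> an initial piece of the unit
    interval. Whether \<open>\<theta>s\<close> belongs to \<open>S\<close> is left open, so facts at
    \<open>w\<close> are obtained as limits.\<close>
  define \<theta>s where "\<theta>s = Sup S"
  have \<theta>s: "0 \<le> \<theta>s" "\<theta>s \<le> 1"
    using S0 bdd by (auto simp: \<theta>s_def S_def intro!: cSup_upper cSup_least)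
  have left: "\<theta> \<in> S" if \<theta>: "0 \<le> \<theta>" "\<theta> < \<theta>s" for \<theta>
  proof -
    obtain \<theta>' where "\<theta>' \<in> S" "\<theta> < \<theta>'"
      using \<theta>(2) S0 unfolding \<theta>s_def by (metis empty_iff less_cSup_iff bdd)
    then show ?thesis using zmono[of \<theta> \<theta>'] \<theta> unfolding S_def by (auto intro: order_trans)
  qed
  have right: "\<theta> \<notin> S" if "\<theta>s < \<theta>" for \<theta>
    using that bdd cSup_upper[of \<theta> S] unfolding \<theta>s_def by auto
  define w where "w = z \<theta>s"
  have w: "w \<in> orthant d" using z \<theta>s by (simp add: w_def)

  have "\<exists>i<d. \<mu> i \<le> grad d g w i"
  proof (cases "\<theta>s < 1")
    case False
    then have "\<theta>s = 1" using \<theta>s by simp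
    then show ?thesis using above by (auto simp: w_def z_def intro!: exI[of _ k])
  next
    case True
    \<comment> \<open>One axis works for all later points: otherwise each axis has a later point
      with slope at most \<open>\<mu> i\<close>, and by monotonicity the earliest of these points
      would lie in \<open>S\<close>.\<close>
    have "\<exists>i<d. \<forall>\<theta>\<in>{\<theta>s<..1}. \<mu> i < grad d g (z \<theta>) i"
    proof (rule ccontr)
      assume "\<not> ?thesis"
      then have "\<forall>i<d. \<exists>\<theta>\<in>{\<theta>s<..1}. grad d g (z \<theta>) i \<le> \<mu> i"
        by (meson not_le)
      then obtain r where r: "\<And>i. i < d \<Longrightarrow> r i \<in> {\<theta>s<..1} \<and> grad d g (z (r i)) i \<le> \<mu> i"
        by metis
      define \<rho> where "\<rho> = Min (insert 1 (r ` {..<d}))"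
      have \<rho>: "\<theta>s < \<rho>" "\<rho> \<le> 1" using True r by (auto simp: \<rho>_def)
      have "grad d g (z \<rho>) i \<le> \<mu> i" if "i < d" for i
      proof -
        have "\<rho> \<le> r i" using that by (auto simp: \<rho>_def)
        then have "grad d g (z \<rho>) i \<le> grad d g (z (r i)) i" using \<rho> \<theta>s by (intro zmono) auto
        then show ?thesis using r[OF that] by linarith
      qed
      then have "\<rho> \<in> S" using \<rho> \<theta>s by (auto simp: S_def)
      then show False using right \<rho> by auto
    qed
    then obtain i where i: "i < d" "\<And>\<theta>. \<theta>s < \<theta> \<Longrightarrow> \<theta> \<le> 1 \<Longrightarrow> \<mu> i < grad d g (z \<theta>) i"
      by auto
    have "\<mu> i \<le> dot d (grad d g w) (axis_vec i 1)"
    proof (rule directional_derivative_ge[OF w])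
      show "(\<lambda>j. w j + axis_vec i 1 j) \<in> orthant d"
        using w i by (intro orthant_add axis_vec_in_orthant) auto
      fix t :: real assume t: "0 < t" "t \<le> 1"
      have ax: "(\<lambda>j. t * axis_vec i 1 j) \<in> orthant d"
        using i t by (intro orthant_scale axis_vec_in_orthant) auto
      \<comment> \<open>The cost increase for a fixed step \<open>t\<close> along axis
        \<open>i\<close>. It is at least \<open>t * \<mu> i\<close> to the right of
        \<open>\<theta>s\<close> and continuous in \<theta>, so the bound passes to
        \<open>\<theta>s\<close>.\<close>
      define h where "h \<theta> = g (\<lambda>j. (a j + t * axis_vec i 1 j) + \<theta> * b j) - g (\<lambda>j. a j + \<theta> * b j)" for \<theta>
      have "t * \<mu> i \<le> h \<theta>s"
      proof (rule continuous_ge_on_closure[where S = "{\<theta>s<..1}" and f = h])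
        have "continuous_on {0..} h"
          unfolding h_def
          by (intro continuous_on_diff continuous_on_g_line a b orthant_add ax)
        then show "continuous_on (closure {\<theta>s<..1}) h"
          using \<theta>s True by (auto elim!: continuous_on_subset)
        show "\<theta>s \<in> closure {\<theta>s<..1}" using True by simp
        fix \<theta> assume \<theta>: "\<theta> \<in> {\<theta>s<..1}"
        have "g (z \<theta>) + dot d (grad d g (z \<theta>)) (\<lambda>j. (z \<theta> j + t * axis_vec i 1 j) - z \<theta> j)
            \<le> g (\<lambda>j. z \<theta> j + t * axis_vec i 1 j)"
          using \<theta> \<theta>s ax z by (intro gradient_inequality orthant_add) auto
        also have "dot d (grad d g (z \<theta>)) (\<lambda>j. (z \<theta> j + t * axis_vec i 1 j) - z \<theta> j)
            = t * grad d g (z \<theta>) i"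
          using i by (simp add: dot_scale_right dot_axis_vec)
        finally have "t * grad d g (z \<theta>) i \<le> h \<theta>"
          by (simp add: h_def z_def algebra_simps)
        moreover have "t * \<mu> i \<le> t * grad d g (z \<theta>) i"
          using t i(2)[of \<theta>] \<theta> by (intro mult_left_mono) auto
        ultimately show "t * \<mu> i \<le> h \<theta>" by linarith
      qed
      then show "g w + t * \<mu> i \<le> g (\<lambda>j. w j + t * axis_vec i 1 j)"
        by (simp add: h_def w_def z_def algebra_simps)
    qed
    then show ?thesis using i by (auto simp: dot_axis_vec)
  qed
  then obtain i where i: "i < d" "\<mu> i \<le> grad d g w i" by auto

  have back_step: "g (z \<theta>) - t * dot d \<mu> (z \<theta>) \<le> g (\<lambda>i. (1 - t) * z \<theta> i)"
    if "\<theta> \<in> S" "0 < t" "t \<le> 1" for \<theta> t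
  proof -
    have z': "z \<theta> \<in> orthant d" using that z by (auto simp: S_def)
    then have "g (z \<theta>) + dot d (grad d g (z \<theta>)) (\<lambda>i. (1 - t) * z \<theta> i - z \<theta> i) \<le> g (\<lambda>i. (1 - t) * z \<theta> i)"
      using that by (intro gradient_inequality orthant_scale) auto
    moreover have "dot d (grad d g (z \<theta>)) (\<lambda>i. (1 - t) * z \<theta> i - z \<theta> i) = - t * dot d (grad d g (z \<theta>)) (z \<theta>)"
      unfolding dot_diff_right dot_scale_right by (simp add: algebra_simps)
    moreover have "dot d (grad d g (z \<theta>)) (z \<theta>) \<le> dot d \<mu> (z \<theta>)"
      using that z' by (intro dot_mono_left) (auto simp: S_def)
    ultimately show ?thesis
      using mult_left_mono[of "dot d (grad d g (z \<theta>)) (z \<theta>)" "dot d \<mu> (z \<theta>)" t] that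
      by linarith
  qed
  \<comment> \<open>For \<theta> in \<open>S\<close>, shrinking \<open>z \<theta>\<close> by the
    factor \<open>1 - t\<close> saves at most \<open>t * dot d \<mu> (z \<theta>)\<close> of cost.
    If \<open>\<theta>s\<close> is not in \<open>S\<close>, the bound at \<open>w\<close> is the
    limit from the left.\<close>
  have "- dot d \<mu> w \<le> dot d (grad d g w) (\<lambda>i. - w i)"
  proof (rule directional_derivative_ge[OF w])
    show "(\<lambda>i. w i + - w i) \<in> orthant d" by (simp add: zero_in_orthant)
    fix t :: real assume t: "0 < t" "t \<le> 1"
    have "g w - t * dot d \<mu> w \<le> g (\<lambda>i. (1 - t) * w i)"
    proof (cases "\<theta>s \<in> S")
      case True
      then show ?thesis using back_step t by (simp add: w_def)
    next
      case False
      then have pos: "0 < \<theta>s" using S0 \<theta>s by (metis less_eq_real_def)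
      define h where "h \<theta> = g (\<lambda>j. (1 - t) * a j + \<theta> * ((1 - t) * b j)) - g (\<lambda>j. a j + \<theta> * b j)
           + t * (dot d \<mu> a + \<theta> * dot d \<mu> b)" for \<theta>
      have h: "h \<theta> = g (\<lambda>i. (1 - t) * z \<theta> i) - g (z \<theta>) + t * dot d \<mu> (z \<theta>)" for \<theta>
        by (simp add: h_def z_def dot_add_right dot_scale_right algebra_simps)
      have "0 \<le> h \<theta>s"
      proof (rule continuous_ge_on_closure[where S = "{0..<\<theta>s}" and f = h])
        have "continuous_on {0..} h"
          unfolding h_def using t
          by (intro continuous_intros continuous_on_g_line a b orthant_scale) auto
        then show "continuous_on (closure {0..<\<theta>s}) h"
          using pos by (auto elim!: continuous_on_subset)
        show "\<theta>s \<in> closure {0..<\<theta>s}" using pos by simp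
        show "0 \<le> h \<theta>" if "\<theta> \<in> {0..<\<theta>s}" for \<theta>
          using back_step[OF left t, of \<theta>] that unfolding h by auto
      qed
      then show ?thesis by (simp add: h w_def)
    qed
    then show "g w + t * - dot d \<mu> w \<le> g (\<lambda>i. w i + t * - w i)"
      by (simp add: algebra_simps)
  qed
  then have back_dir: "dot d (grad d g w) w \<le> dot d \<mu> w" by (simp add: dot_minus_right)
  have "gi_star g i (\<mu> i) \<le> dot d \<mu> w - g w"
  proof (rule gi_star_least)
    fix t :: real assume t: "0 \<le> t"
    have "g w + dot d (grad d g w) (\<lambda>j. axis_vec i t j - w j) \<le> g (axis_vec i t)"
      using i t w by (intro gradient_inequality axis_vec_in_orthant)
    moreover have "\<mu> i * t \<le> grad d g w i * t" using i t by (intro mult_right_mono)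
    ultimately show "\<mu> i * t - g (axis_vec i t) \<le> dot d \<mu> w - g w"
      using i back_dir by (simp add: dot_diff_right dot_axis_vec)
  qed
  then show ?thesis using that[of \<theta>s i] i \<theta>s by (simp add: w_def z_def)
qed

subsection \<open>Conjugates and the curve\<close>

lemma dot_grad_axis_diff:
  "i < d \<Longrightarrow> dot d D (\<lambda>j. axis_vec i t j - axis_vec i t' j) = D i * (t - t')"
  by (simp add: dot_diff_right dot_axis_vec algebra_simps)

text \<open>The axis slope tends to infinity, so it reaches \<open>u\<close> at some
  \<open>r\<close>, and the tangent there bounds \<open>u * t - g (axis_vec i t)\<close> uniformly
  in \<open>t\<close>. This finiteness gives the supremum in \<open>gi_star\<close> its
  meaning.\<close>

lemma gi_star_upper:
  assumes i: "i < d" and t: "0 \<le> t"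
  shows "u * t - g (axis_vec i t) \<le> gi_star g i u"
proof -
  have scale: "(\<lambda>j. t * axis_vec i 1 j) = axis_vec i t" for t
    by (auto simp: axis_vec_def)
  have "axis_vec i 1 \<noteq> (\<lambda>_. 0)" by (auto simp: axis_vec_def fun_eq_iff)
  moreover have "axis_vec i 1 \<in> orthant d" using i by (simp add: axis_vec_in_orthant)
  ultimately have "filterlim (\<lambda>t. dot d (grad d g (\<lambda>j. t * axis_vec i 1 j)) (axis_vec i 1)) at_top at_top"
    using admissible unfolding admissible_cost_def by metis
  then have "filterlim (\<lambda>t. dot d (grad d g (axis_vec i t)) (axis_vec i 1)) at_top at_top"
    by (simp only: scale)
  then have "\<forall>\<^sub>F t in at_top. u \<le> dot d (grad d g (axis_vec i t)) (axis_vec i 1)"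
    by (simp add: filterlim_at_top)
  then have "\<forall>\<^sub>F t in at_top. 0 \<le> t \<and> u \<le> dot d (grad d g (axis_vec i t)) (axis_vec i 1)"
    by (intro eventually_conj eventually_ge_at_top)
  then obtain r where r: "0 \<le> r" "u \<le> grad d g (axis_vec i r) i"
    using i by (auto simp: eventually_at_top_linorder dot_axis_vec)
  let ?D = "grad d g (axis_vec i r) i"
  have "u * t - g (axis_vec i t) \<le> ?D * r" if "0 \<le> t" for t
  proof -
    have "g (axis_vec i r) + ?D * (t - r) \<le> g (axis_vec i t)"
      using gradient_inequality[of "axis_vec i r" "axis_vec i t"] i that r
      by (simp add: axis_vec_in_orthant dot_grad_axis_diff)
    moreover have "0 \<le> g (axis_vec i r)" using i r by (intro g_nonneg axis_vec_in_orthant)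
    moreover have "u * t \<le> ?D * t" using r that by (intro mult_right_mono)
    ultimately show ?thesis by (simp add: algebra_simps)
  qed
  then have "bdd_above ((\<lambda>t. u * t - g (axis_vec i t)) ` {0..})" by (auto intro!: bdd_aboveI)
  then show ?thesis unfolding gi_star_def using t by (intro cSUP_upper) auto
qed

lemma gi_star_nonneg: "i < d \<Longrightarrow> 0 \<le> gi_star g i u"
  using gi_star_upper[of i 0 u] by (simp add: axis_vec_def)

lemma gi_star_mono:
  assumes "i < d" "u \<le> u'"
  shows "gi_star g i u \<le> gi_star g i u'"
proof (rule gi_star_least)
  fix t :: real assume t: "0 \<le> t"
  have "u * t \<le> u' * t" using assms t by (intro mult_right_mono)
  then show "u * t - g (axis_vec i t) \<le> gi_star g i u'"
    using gi_star_upper[OF assms(1) t, of u'] by linarith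
qed

lemma gi_star_eq_0:
  assumes "i < d" "u \<le> grad d g (\<lambda>_. 0) i"
  shows "gi_star g i u = 0"
proof (rule antisym[OF gi_star_least gi_star_nonneg[OF assms(1)]])
  fix t :: real assume t: "0 \<le> t"
  have "dot d (grad d g (\<lambda>_. 0)) (axis_vec i t) \<le> g (axis_vec i t)"
    using gradient_inequality[OF zero_in_orthant axis_vec_in_orthant[OF assms(1) t]] by simp
  moreover have "u * t \<le> grad d g (\<lambda>_. 0) i * t" using assms t by (intro mult_right_mono)
  ultimately show "u * t - g (axis_vec i t) \<le> 0" using assms by (simp add: dot_axis_vec)
qed

lemma grad_zero_nonneg:
  assumes "i < d"
  shows "0 \<le> grad d g (\<lambda>_. 0) i"
proof -
  have "0 \<le> dot d (grad d g (\<lambda>_. 0)) (axis_vec i 1)"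
    by (rule directional_derivative_ge)
      (use assms in \<open>auto intro!: zero_in_orthant axis_vec_in_orthant g_nonneg orthant_scale\<close>)
  then show ?thesis using assms by (simp add: dot_axis_vec)
qed

lemma gi_star_pos_imp:
  assumes "i < d" "0 < gi_star g i u"
  shows "grad d g (\<lambda>_. 0) i < u" "0 < u"
  using assms gi_star_eq_0[of i u] grad_zero_nonneg[of i] by force+

text \<open>A near-maximiser \<open>t\<close> for \<open>u\<close> satisfies
  \<open>u * t \<ge> \<tau> / 2\<close>, hence stays away from 0, and raising the slope gains in
  proportion to \<open>t\<close>.\<close>

lemma gi_star_strict_mono:
  assumes i: "i < d" and u: "u < u'" and pos: "0 < gi_star g i u"
  shows "gi_star g i u < gi_star g i u'"
proof -
  have u0: "0 < u" using gi_star_pos_imp i pos by blast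
  define \<tau> where "\<tau> = gi_star g i u"
  \<comment> \<open>The gain guaranteed by \<open>t \<ge> \<tau> / (2 * u)\<close>. The slack of the
    near-maximiser is below both \<open>\<tau> / 2\<close>, to get this bound on \<open>t\<close>,
    and \<open>\<delta>\<close>, to be outweighed by the gain.\<close>
  define \<delta> where "\<delta> = (u' - u) * (\<tau> / (2 * u))"
  have \<delta>: "0 < \<delta>" using u u0 pos by (simp add: \<delta>_def \<tau>_def)
  have "\<tau> - min (\<tau> / 2) \<delta> < gi_star g i u" using \<delta> pos by (simp add: \<tau>_def)
  then obtain t where t: "0 \<le> t" "\<tau> - min (\<tau> / 2) \<delta> < u * t - g (axis_vec i t)"
    using gi_star_least[of u i "\<tau> - min (\<tau> / 2) \<delta>"] by (meson not_le)
  have "0 \<le> g (axis_vec i t)" using i t by (intro g_nonneg axis_vec_in_orthant)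
  then have "\<tau> / 2 \<le> u * t" using t by linarith
  then have "\<tau> / (2 * u) \<le> t" using u0 by (simp add: field_simps)
  then have "\<delta> \<le> (u' - u) * t" unfolding \<delta>_def using u by (intro mult_left_mono) auto
  then have "\<tau> < u' * t - g (axis_vec i t)" using t by (simp add: algebra_simps)
  also have "\<dots> \<le> gi_star g i u'" using i t by (intro gi_star_upper)
  finally show ?thesis by (simp add: \<tau>_def)
qed

text \<open>A supremum of affine functions is convex, and a finite convex function on the line is
  continuous.\<close>

lemma continuous_on_gi_star:
  assumes i: "i < d"
  shows "continuous_on UNIV (gi_star g i)"
proof (rule convex_on_continuous)
  show "convex_on UNIV (gi_star g i)"
  proof (rule convex_onI)
    fix r x y :: real assume r: "0 < r" "r < 1"
    show "gi_star g i ((1 - r) *\<^sub>R x + r *\<^sub>R y) \<le> (1 - r) * gi_star g i x + r * gi_star g i y"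
    proof (rule gi_star_least)
      fix t :: real assume t: "0 \<le> t"
      have "(1 - r) * (x * t - g (axis_vec i t)) + r * (y * t - g (axis_vec i t))
          \<le> (1 - r) * gi_star g i x + r * gi_star g i y"
        using r i t by (intro add_mono mult_left_mono gi_star_upper) auto
      then show "((1 - r) *\<^sub>R x + r *\<^sub>R y) * t - g (axis_vec i t)
          \<le> (1 - r) * gi_star g i x + r * gi_star g i y"
        by (simp add: algebra_simps)
    qed
  qed simp
qed simp

lemma gi_star_surj:
  assumes i: "i < d" and \<tau>: "0 < \<tau>"
  shows "\<exists>u. gi_star g i u = \<tau>"
proof -
  \<comment> \<open>At slope \<open>?b\<close> the point \<open>t = 1\<close> already yields the
    value \<tau>, while at slope 0 the conjugate vanishes.\<close>
  let ?b = "\<tau> + g (axis_vec i 1)"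
  have "0 \<le> g (axis_vec i 1)" using i by (intro g_nonneg axis_vec_in_orthant) auto
  then have "\<exists>u\<ge>0. u \<le> ?b \<and> gi_star g i u = \<tau>"
    using gi_star_eq_0[OF i grad_zero_nonneg[OF i]] gi_star_upper[OF i, of 1 ?b] \<tau>
    by (intro IVT' continuous_on_subset[OF continuous_on_gi_star[OF i]]) auto
  then show ?thesis by blast
qed

text \<open>The definite description denotes: existence is surjectivity of each conjugate onto the
  positive reals, uniqueness is its strict monotonicity at positive values.\<close>

lemma curve_point:
  assumes \<tau>: "0 < \<tau>"
  shows curve_point_in_vecs: "curve_point d g \<tau> \<in> vecs d"
    and gi_star_curve_point: "\<And>i. i < d \<Longrightarrow> gi_star g i (curve_point d g \<tau> i) = \<tau>"
proof -
  obtain l where l: "\<And>i. i < d \<Longrightarrow> gi_star g i (l i) = \<tau>"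
    using gi_star_surj[OF _ \<tau>] by metis
  let ?P = "\<lambda>l. l \<in> vecs d \<and> (\<forall>i<d. gi_star g i (l i) = \<tau>)"
  have "?P (curve_point d g \<tau>)"
    unfolding curve_point_def
  proof (rule theI[of ?P])
    show "?P (\<lambda>i. if i < d then l i else 0)" using l by (simp add: vecs_def)
    fix k assume k: "?P k"
    show "k = (\<lambda>i. if i < d then l i else 0)"
    proof
      fix i
      show "k i = (if i < d then l i else 0)"
      proof (cases "i < d")
        case True
        then show ?thesis
          using k l[OF True] \<tau> gi_star_strict_mono[OF True, of "k i" "l i"]
            gi_star_strict_mono[OF True, of "l i" "k i"]
          by (cases "k i" "l i" rule: linorder_cases) auto
      qed (use k in \<open>auto simp: vecs_def\<close>)
    qed
  qed
  then show "curve_point d g \<tau> \<in> vecs d"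
    "\<And>i. i < d \<Longrightarrow> gi_star g i (curve_point d g \<tau> i) = \<tau>" by auto
qed

lemma curve_point_pos: "0 < \<tau> \<Longrightarrow> i < d \<Longrightarrow> 0 < curve_point d g \<tau> i"
  using gi_star_pos_imp(2) gi_star_curve_point by fastforce

lemma curve_point_in_orthant: "0 < \<tau> \<Longrightarrow> curve_point d g \<tau> \<in> orthant d"
  using curve_point_pos curve_point_in_vecs by (force simp: orthant_def)

lemma le_curve_point:
  assumes "0 < \<tau>" "i < d" "gi_star g i u < \<tau>"
  shows "u < curve_point d g \<tau> i"
  using assms gi_star_mono[of i "curve_point d g \<tau> i" u] gi_star_curve_point[of \<tau> i] by force

lemma curve_point_strict_mono:
  assumes "0 < \<tau>" "\<tau> < \<tau>'" "i < d"
  shows "curve_point d g \<tau> i < curve_point d g \<tau>' i"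
  using assms by (intro le_curve_point) (auto simp: gi_star_curve_point)

lemma curve_point_mono:
  assumes "0 < \<tau>" "\<tau> \<le> \<tau>'"
  shows "curve_point d g \<tau> \<le> curve_point d g \<tau>'"
proof (cases "\<tau> = \<tau>'")
  case False
  then show ?thesis
    using assms curve_point_strict_mono[of \<tau> \<tau>']
    by (intro orthant_le[of _ d] curve_point_in_orthant curve_point_in_vecs less_imp_le) auto
qed simp

section \<open>The position of the initial path relative to the curve\<close>

lemma axis_slopes_eq:
  assumes i: "i < d"
  shows "axis_slopes d g i = grad d g (\<lambda>_. 0) i"
proof -
  have "axis_vec i 1 \<in> vecs d" using i by (auto simp: vecs_def axis_vec_def)
  then have "((\<lambda>t. g (\<lambda>j. 0 + t * axis_vec i 1 j)) has_real_derivative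
      dot d (grad d g (\<lambda>j. 0 + 0 * axis_vec i 1 j)) (axis_vec i 1)) (at 0 within {t. (\<lambda>j. 0 + t * axis_vec i 1 j) \<in> orthant d})"
    by (intro g_along_line) (simp_all add: zero_in_orthant)
  also have "(\<lambda>t. g (\<lambda>j. 0 + t * axis_vec i 1 j)) = (\<lambda>t. g (axis_vec i t))"
    by (rule ext, rule arg_cong[of _ _ g]) (auto simp: axis_vec_def)
  finally have "((\<lambda>t. g (axis_vec i t)) has_real_derivative grad d g (\<lambda>_. 0) i)
      (at 0 within {t. (\<lambda>j. 0 + t * axis_vec i 1 j) \<in> orthant d})"
    using i by (simp add: dot_axis_vec)
  then have "((\<lambda>t. g (axis_vec i t)) has_real_derivative grad d g (\<lambda>_. 0) i) (at 0 within {0..})"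
    by (rule has_field_derivative_subset)
      (use i in \<open>auto intro!: orthant_scale axis_vec_in_orthant\<close>)
  then have "((\<lambda>t. g (axis_vec i t)) has_vector_derivative grad d g (\<lambda>_. 0) i) (at 0 within {0..})"
    by (simp add: has_real_derivative_iff_has_vector_derivative)
  moreover have "at 0 within {0::real..} \<noteq> bot"
    by (simp add: at_within_Ici_at_right)
  ultimately show ?thesis
    using i by (simp add: axis_slopes_def vector_derivative_within)
qed

lemma axis_slopes_le_curve_point:
  assumes "0 < \<tau>"
  shows "axis_slopes d g \<le> curve_point d g \<tau>"
proof (rule le_funI)
  fix i
  show "axis_slopes d g i \<le> curve_point d g \<tau> i"
  proof (cases "i < d")
    case True
    then show ?thesis
      using gi_star_pos_imp(1)[OF True, of "curve_point d g \<tau> i"] gi_star_curve_point[OF assms True] assms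
      by (simp add: axis_slopes_eq)
  next
    case False
    then show ?thesis using curve_point_in_vecs[OF assms] by (auto simp: vecs_def axis_slopes_def)
  qed
qed

text \<open>The path is monotone and ends at the axis slopes, which lie below every curve point
  because the conjugates vanish up to these slopes.\<close>

lemma threshold_curve_cases:
  assumes "threshold_curve d g \<C>" "\<mu> \<in> \<C>"
  obtains (curve) \<tau> where "0 < \<tau>" "\<mu> = curve_point d g \<tau>"
  | (path) "\<And>\<tau>. 0 < \<tau> \<Longrightarrow> \<mu> \<le> curve_point d g \<tau>"
proof -
  obtain \<gamma> where \<gamma>: "mono_on {0..1} \<gamma>" "pathfinish \<gamma> = axis_slopes d g"
    "\<C> = curve_point d g ` {0<..} \<union> path_image \<gamma>"
    using assms(1) by (auto simp: threshold_curve_def)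
  have "\<mu> \<le> curve_point d g \<tau>" if path: "\<mu> \<in> path_image \<gamma>" and "0 < \<tau>" for \<tau>
  proof -
    obtain r where r: "r \<in> {0..1}" "\<mu> = \<gamma> r" using path by (auto simp: path_image_def)
    then have "\<mu> \<le> \<gamma> 1" using \<gamma>(1) by (auto simp: mono_on_def)
    also have "\<gamma> 1 = axis_slopes d g" using \<gamma>(2) by (simp add: pathfinish_def)
    also have "\<dots> \<le> curve_point d g \<tau>" using that by (intro axis_slopes_le_curve_point)
    finally show ?thesis .
  qed
  then show ?thesis using assms(2) \<gamma>(3) curve path by (auto simp: greaterThan_def)
qed

lemma curve_point_in_curve:
  "threshold_curve d g \<C> \<Longrightarrow> 0 < \<tau> \<Longrightarrow> curve_point d g \<tau> \<in> \<C>"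
  by (auto simp: threshold_curve_def)

text \<open>The separable bound \<open>sum_axes_le_g\<close> followed by the Fenchel-Young
  inequality on each axis. At a curve point the right-hand side is \<open>d * \<tau>\<close>, the
  source of the factor \<open>d\<close>.\<close>

lemma dot_le_conjugates:
  assumes "y \<in> orthant d"
  shows "dot d \<mu> y - g y \<le> (\<Sum>i<d. gi_star g i (\<mu> i))"
proof -
  have "dot d \<mu> y - g y \<le> (\<Sum>i<d. \<mu> i * y i - g (axis_vec i (y i)))"
    using sum_axes_le_g[OF assms] by (simp add: dot_def sum_subtractf)
  also have "\<dots> \<le> (\<Sum>i<d. gi_star g i (\<mu> i))"
    using assms by (intro sum_mono gi_star_upper) (auto simp: orthant_def)
  finally show ?thesis .
qed

text \<open>Left continuity of the curve in terms of conjugates: lowering each coordinate by a small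
  \<open>\<delta>\<close> pushes its conjugate value below \<open>t\<close>, and curve points with
  larger parameters dominate the lowered vector. It is used to show that a supremum of good
  parameters is good.\<close>

lemma dot_curve_point_left_limit:
  assumes t: "0 < t" and y: "y \<in> orthant d" and c: "c < dot d (curve_point d g t) y"
  obtains r where "r < t" "\<And>\<tau>. 0 < \<tau> \<Longrightarrow> r < \<tau> \<Longrightarrow> c < dot d (curve_point d g \<tau>) y"
proof -
  let ?l = "curve_point d g"
  \<comment> \<open>The \<open>+ 1\<close> keeps the denominator positive and makes the total loss
    \<open>\<delta> * (\<Sum>i<d. y i)\<close> strictly smaller than the gap.\<close>
  define \<delta> where "\<delta> = (dot d (?l t) y - c) / ((\<Sum>i<d. y i) + 1)"
  have y0: "0 \<le> (\<Sum>i<d. y i)" using y by (intro sum_nonneg) (auto simp: orthant_def)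
  then have \<delta>: "0 < \<delta>" using c by (simp add: \<delta>_def)
  have "\<delta> * ((\<Sum>i<d. y i) + 1) = dot d (?l t) y - c" using y0 by (simp add: \<delta>_def)
  then have small: "\<delta> * (\<Sum>i<d. y i) < dot d (?l t) y - c" using \<delta> by (simp add: algebra_simps)
  define r where "r = Max (insert 0 ((\<lambda>i. gi_star g i (?l t i - \<delta>)) ` {..<d}))"
  show ?thesis
  proof
    have "gi_star g i (?l t i - \<delta>) < t" if "i < d" for i
      using gi_star_strict_mono[OF that, of "?l t i - \<delta>" "?l t i"] gi_star_curve_point[OF t that]
        gi_star_nonneg[OF that, of "?l t i - \<delta>"] \<delta> t by (cases "gi_star g i (?l t i - \<delta>) = 0") auto
    then show "r < t" using t by (auto simp: r_def)
    fix \<tau> assume \<tau>: "0 < \<tau>" "r < \<tau>"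
    have "?l t i - \<delta> \<le> ?l \<tau> i" if "i < d" for i
    proof -
      have "gi_star g i (?l t i - \<delta>) \<le> r" using that by (auto simp: r_def)
      then show ?thesis using le_curve_point[OF \<tau>(1) that] \<tau> by (intro less_imp_le) auto
    qed
    then have "dot d (\<lambda>i. ?l t i - \<delta>) y \<le> dot d (?l \<tau>) y" using y by (intro dot_mono_left)
    moreover have "dot d (\<lambda>i. ?l t i - \<delta>) y = dot d (?l t) y - \<delta> * (\<Sum>i<d. y i)"
      by (simp add: dot_def left_diff_distrib sum_subtractf sum_distrib_left)
    ultimately show "c < dot d (?l \<tau>) y" using small by linarith
  qed
qed

end

section \<open>Fractional profit and the greedy rule\<close>

lemma load_add: "load n s (\<lambda>e. x e + y e) = (\<lambda>i. load n s x i + load n s y i)"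
  by (simp add: load_def distrib_left sum.distrib)

lemma dot_load: "dot d \<mu> (load n s x) = (\<Sum>e<n. dot d \<mu> (s e) * x e)"
  unfolding dot_def load_def sum_distrib_left sum_distrib_right
  by (subst sum.swap) (simp add: mult.assoc)

definition only_item :: "nat \<Rightarrow> real \<Rightarrow> nat \<Rightarrow> real" where
  "only_item e t = (\<lambda>k. if k = e then t else 0)"

lemma only_item_nonneg: "0 \<le> t \<Longrightarrow> 0 \<le> only_item e t k"
  by (simp add: only_item_def)

lemma load_only_item: "e < n \<Longrightarrow> load n s (only_item e t) = (\<lambda>i. t * s e i)"
  by (simp add: load_def only_item_def if_distrib sum.delta mult.commute cong: if_cong)

lemma sum_only_item: "e < n \<Longrightarrow> (\<Sum>k<n. v k * only_item e t k) = (v e * t :: real)"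
  by (simp add: only_item_def if_distrib sum.delta cong: if_cong)

lemma indicator_insert_only_item:
  "e \<notin> A \<Longrightarrow> indicator (insert e A) = (\<lambda>k. indicator A k + only_item e 1 k)"
  by (auto simp: only_item_def indicator_def)

definition restrict_to :: "nat set \<Rightarrow> (nat \<Rightarrow> real) \<Rightarrow> nat \<Rightarrow> real" where
  "restrict_to A x = (\<lambda>e. if e \<in> A then x e else 0)"

lemma restrict_to_nonneg: "(\<And>e. 0 \<le> x e) \<Longrightarrow> 0 \<le> restrict_to A x e"
  by (simp add: restrict_to_def)

text \<open>The feasible region of the supremum in \<open>fopt\<close>.\<close>

definition fractional :: "nat set \<Rightarrow> (nat \<Rightarrow> real) set" where
  "fractional A = {x. (\<forall>e. x e \<in> {0..1}) \<and> (\<forall>e. e \<notin> A \<longrightarrow> x e = 0)}"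

lemma fractionalD: "x \<in> fractional A \<Longrightarrow> 0 \<le> x e" "x \<in> fractional A \<Longrightarrow> x e \<le> 1"
  "x \<in> fractional A \<Longrightarrow> e \<notin> A \<Longrightarrow> x e = 0"
  by (auto simp: fractional_def)

lemma restrict_to_in_fractional: "x \<in> fractional B \<Longrightarrow> restrict_to A x \<in> fractional (A \<inter> B)"
  by (auto simp: fractional_def restrict_to_def)

lemma indicator_in_fractional: "indicator A \<in> fractional A"
  by (auto simp: fractional_def indicator_def)

locale profit_instance = cost_function d g for d g +
  fixes n :: nat and v :: "nat \<Rightarrow> real" and s :: "nat \<Rightarrow> rvec"
  assumes value_nonneg: "e < n \<Longrightarrow> 0 \<le> v e"
    and size_in_orthant: "e < n \<Longrightarrow> s e \<in> orthant d"
begin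

abbreviation \<pi> :: "(nat \<Rightarrow> real) \<Rightarrow> real" where
  "\<pi> \<equiv> profit n v s g"

abbreviation fo :: "nat set \<Rightarrow> real" where
  "fo \<equiv> fopt n v s g"

lemma load_in_orthant:
  assumes "\<And>e. 0 \<le> x e"
  shows "load n s x \<in> orthant d"
  using size_in_orthant assms unfolding orthant_def vecs_def load_def
  by (auto intro!: sum_nonneg)

section \<open>Profit and the two optima\<close>

lemma profit_zero [simp]: "\<pi> (\<lambda>_. 0) = 0"
  by (simp add: profit_def load_def)

lemma profit_empty [simp]: "\<pi> (indicator {}) = 0"
  by (simp add: profit_def load_def)

text \<open>Diminishing returns: the value part is linear and cancels, leaving supermodularity of
  \<open>g\<close>.\<close>

lemma profit_submodular:
  assumes "\<And>e. 0 \<le> x e" "\<And>e. 0 \<le> y e" "\<And>e. 0 \<le> z e"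
  shows "\<pi> (\<lambda>e. x e + y e + z e) - \<pi> (\<lambda>e. x e + y e) \<le> \<pi> (\<lambda>e. x e + z e) - \<pi> x"
  using g_supermodular[of "load n s x" "load n s y" "load n s z"] load_in_orthant assms
  by (simp add: profit_def load_add distrib_left sum.distrib)

lemma profit_subadditive:
  assumes "\<And>e. 0 \<le> x e" "\<And>e. 0 \<le> y e"
  shows "\<pi> (\<lambda>e. x e + y e) \<le> \<pi> x + \<pi> y"
  using profit_submodular[of "\<lambda>_. 0" x y] assms by simp

lemma profit_only_item: "e < n \<Longrightarrow> \<pi> (only_item e t) = t * v e - g (\<lambda>i. t * s e i)"
  by (simp add: profit_def load_only_item sum_only_item mult.commute)

lemma profit_le_sum_values:
  assumes "x \<in> fractional A"
  shows "\<pi> x \<le> (\<Sum>e<n. v e)"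
proof -
  have "\<pi> x \<le> (\<Sum>e<n. v e * x e)"
    using g_nonneg[OF load_in_orthant[of x]] fractionalD(1)[OF assms] by (simp add: profit_def)
  also have "\<dots> \<le> (\<Sum>e<n. v e)"
    using value_nonneg fractionalD[OF assms] by (intro sum_mono mult_left_le) auto
  finally show ?thesis .
qed

lemma bdd_above_profit: "bdd_above (\<pi> ` fractional A)"
  by (auto intro!: bdd_aboveI profit_le_sum_values)

lemma fopt_eq_SUP: "fo A = (SUP x\<in>fractional A. \<pi> x)"
  by (simp only: fopt_def fractional_def)

lemma fopt_upper: "x \<in> fractional A \<Longrightarrow> \<pi> x \<le> fo A"
  unfolding fopt_eq_SUP by (rule cSUP_upper[OF _ bdd_above_profit])

lemma fopt_witness:
  assumes "c < fo A"
  obtains x where "x \<in> fractional A" "c < \<pi> x"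
proof -
  have "fractional A \<noteq> {}" using indicator_in_fractional by blast
  then show ?thesis
    using assms less_cSUP_iff[OF _ bdd_above_profit] that unfolding fopt_eq_SUP by metis
qed

lemma fopt_least: "(\<And>x. x \<in> fractional A \<Longrightarrow> \<pi> x \<le> c) \<Longrightarrow> fo A \<le> c"
  using fopt_witness[of c A] by (metis not_le)

lemma fopt_mono: "A \<subseteq> B \<Longrightarrow> fo A \<le> fo B"
  by (rule fopt_least, rule fopt_upper) (auto simp: fractional_def)

lemma fopt_nonneg: "0 \<le> fo A"
  using fopt_upper[of "\<lambda>_. 0" A] by (simp add: fractional_def)

text \<open>A fractional solution splits into its parts inside and outside \<open>B\<close>, and
  profit is subadditive.\<close>

lemma fopt_subadditive: "fo A \<le> fo (A \<inter> B) + fo (A - B)"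
proof (rule fopt_least)
  fix x assume x: "x \<in> fractional A"
  have "\<pi> x = \<pi> (\<lambda>e. restrict_to B x e + restrict_to (- B) x e)"
    by (rule arg_cong[of _ _ \<pi>]) (auto simp: restrict_to_def)
  also have "\<dots> \<le> \<pi> (restrict_to B x) + \<pi> (restrict_to (- B) x)"
    using x by (intro profit_subadditive restrict_to_nonneg fractionalD)
  also have "\<dots> \<le> fo (A \<inter> B) + fo (A - B)"
    using restrict_to_in_fractional[OF x, of B] restrict_to_in_fractional[OF x, of "- B"]
    by (intro add_mono fopt_upper) (simp_all add: Int_commute Diff_eq)
  finally show "\<pi> x \<le> fo (A \<inter> B) + fo (A - B)" .
qed

lemma opt_upper: "A \<subseteq> {..<n} \<Longrightarrow> \<pi> (indicator A) \<le> opt n v s g"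
  unfolding opt_def by (intro Max_ge) auto

lemma opt_witness:
  obtains A where "A \<subseteq> {..<n}" "\<pi> (indicator A) = opt n v s g"
proof -
  have "opt n v s g \<in> (\<lambda>A. \<pi> (indicator A)) ` Pow {..<n}"
    unfolding opt_def by (intro Max_in) auto
  then show ?thesis using that by auto
qed

lemma opt_nonneg: "0 \<le> opt n v s g"
  using opt_upper[of "{}"] by simp

lemma opt_le_fopt: "opt n v s g \<le> fo {..<n}"
proof -
  obtain A where A: "A \<subseteq> {..<n}" "\<pi> (indicator A) = opt n v s g" by (rule opt_witness)
  then have "opt n v s g \<le> fo A" using fopt_upper[OF indicator_in_fractional] by metis
  also have "\<dots> \<le> fo {..<n}" using A by (intro fopt_mono)
  finally show ?thesis .
qed

text \<open>
  The marginal profits of the items in index order, with the negative ones dropped; by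
  submodularity they bound the profit of every subset from below.
\<close>

lemma additive_lower_bound:
  assumes x: "x \<in> fractional B" and B: "B \<subseteq> {..<n}" and M: "0 \<le> M"
    and cap: "\<And>e. e < n \<Longrightarrow> \<pi> (only_item e (x e)) \<le> M"
  obtains a where "\<And>e. 0 \<le> a e" "\<And>e. a e \<le> M" "\<pi> x \<le> (\<Sum>e<n. a e)"
    "\<And>A. A \<subseteq> {..<n} \<Longrightarrow> (\<Sum>e\<in>A. a e) \<le> fo (A \<inter> B)"
proof -
  define m where "m e = \<pi> (restrict_to {..<Suc e} x) - \<pi> (restrict_to {..<e} x)" for e
  define a where "a e = (if e < n then max 0 (m e) else 0)" for e
  note nonneg = restrict_to_nonneg[OF fractionalD(1)[OF x]]
  \<comment> \<open>By submodularity the marginal of \<open>e\<close> after the whole prefix is at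
    most its marginal after the part of the prefix in \<open>A\<close>.\<close>
  have m_le: "m e \<le> \<pi> (\<lambda>k. restrict_to (A \<inter> {..<e}) x k + only_item e (x e) k) - \<pi> (restrict_to (A \<inter> {..<e}) x)" for e A
  proof -
    have "(\<lambda>k. restrict_to (A \<inter> {..<e}) x k + restrict_to ({..<e} - A) x k) = restrict_to {..<e} x"
      "(\<lambda>k. restrict_to (A \<inter> {..<e}) x k + restrict_to ({..<e} - A) x k + only_item e (x e) k) = restrict_to {..<Suc e} x"
      by (auto simp: restrict_to_def only_item_def)
    with profit_submodular[of "restrict_to (A \<inter> {..<e}) x" "restrict_to ({..<e} - A) x" "only_item e (x e)"] nonneg
    show ?thesis using fractionalD(1)[OF x] by (simp add: m_def only_item_nonneg)
  qed
  have sum_le: "(\<Sum>e\<in>A \<inter> {..<k}. m e) \<le> \<pi> (restrict_to (A \<inter> {..<k}) x)" for A k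
  proof (induction k)
    case 0
    then show ?case by (simp add: restrict_to_def)
  next
    case (Suc k)
    show ?case
    proof (cases "k \<in> A")
      case True
      then have eq: "A \<inter> {..<Suc k} = insert k (A \<inter> {..<k})" by auto
      have "restrict_to (insert k (A \<inter> {..<k})) x = (\<lambda>j. restrict_to (A \<inter> {..<k}) x j + only_item k (x k) j)"
        by (auto simp: restrict_to_def only_item_def)
      then show ?thesis using Suc m_le[of k A] unfolding eq by simp
    next
      case False
      then have "A \<inter> {..<Suc k} = A \<inter> {..<k}" by (auto simp: less_Suc_eq)
      then show ?thesis using Suc by simp
    qed
  qed
  show ?thesis
  proof (rule that)
    show "0 \<le> a e" for e by (simp add: a_def)
    \<comment> \<open>With \<open>{}\<close> in place of \<open>A\<close>, \<open>m_le\<close>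
      bounds the marginal by the profit of \<open>e\<close> alone.\<close>
    show "a e \<le> M" for e
      using m_le[of e "{}"] cap[of e] M by (auto simp: a_def restrict_to_def)
    have "x e = 0" if "\<not> e < n" for e
      using that B fractionalD(3)[OF x, of e] by auto
    then have "\<pi> x = \<pi> (restrict_to {..<n} x)"
      by (intro arg_cong[of _ _ \<pi>]) (auto simp: restrict_to_def)
    also have "\<dots> = (\<Sum>e<n. m e)"
      unfolding m_def by (subst sum_lessThan_telescope) (simp add: restrict_to_def)
    also have "\<dots> \<le> (\<Sum>e<n. a e)" by (intro sum_mono) (simp add: a_def)
    finally show "\<pi> x \<le> (\<Sum>e<n. a e)" .
    fix A assume A: "A \<subseteq> {..<n}"
    let ?P = "A \<inter> {e. 0 \<le> m e}"
    have "(\<Sum>e\<in>A. a e) = (\<Sum>e\<in>?P. m e)"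
      using A by (intro sum.mono_neutral_cong_right) (auto simp: a_def finite_subset)
    also have "\<dots> \<le> \<pi> (restrict_to ?P x)"
      using sum_le[of ?P n] A by (simp add: Int_absorb2 subset_iff)
    also have "\<dots> \<le> fo (?P \<inter> B)" by (intro fopt_upper restrict_to_in_fractional x)
    also have "\<dots> \<le> fo (A \<inter> B)" by (intro fopt_mono) auto
    finally show "(\<Sum>e\<in>A. a e) \<le> fo (A \<inter> B)" .
  qed
qed

text \<open>A non-exceptional item has a best fraction at an end point of the unit interval. This
  transfers the bound on single-item profits to fractions of items.\<close>

lemma profit_only_item_le:
  assumes e: "e < n" and ne: "\<not> exceptional (v e) (s e) g" and t: "0 \<le> t" "t \<le> 1"
  shows "\<pi> (only_item e t) \<le> max 0 (\<pi> (indicator {e}))"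
proof -
  let ?h = "\<lambda>\<theta>. \<theta> * v e - g (\<lambda>i. \<theta> * s e i)"
  obtain \<theta> where \<theta>: "is_arg_max ?h (\<lambda>\<theta>. \<theta> \<in> {0..1}) \<theta>" "\<theta> \<notin> {0<..<1}"
    using ne unfolding exceptional_def by blast
  then have "\<theta> \<in> {0..1}" by (simp add: is_arg_max_linorder)
  then have "\<theta> = 0 \<or> \<theta> = 1" using \<theta>(2) by auto
  moreover have "?h t \<le> ?h \<theta>" using \<theta>(1) t by (simp add: is_arg_max_linorder)
  moreover have "indicator {e} = only_item e 1" by (auto simp: only_item_def indicator_def)
  ultimately show ?thesis
    using e profit_only_item[OF e, of 1] profit_only_item[OF e, of t] by auto
qed

section \<open>The greedy rule\<close>

lemma load_insert:
  assumes "e \<notin> A" "e < n"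
  shows "load n s (indicator (insert e A)) = (\<lambda>i. load n s (indicator A) i + s e i)"
  using assms by (simp add: indicator_insert_only_item load_add load_only_item)

lemma profit_insert:
  assumes "e \<notin> A" "e < n"
  shows "\<pi> (indicator (insert e A)) = \<pi> (indicator A) + v e
     - (g (\<lambda>i. load n s (indicator A) i + s e i) - g (load n s (indicator A)))"
  using assms sum_only_item[of e n v 1]
  by (simp add: profit_def load_add load_only_item indicator_insert_only_item distrib_left sum.distrib)

text \<open>The fold of \<open>process\<close> with a free starting set, as inductions over the
  arrivals require.\<close>

abbreviation greedy :: "nat set \<Rightarrow> nat list \<Rightarrow> nat set \<Rightarrow> nat set" where
  "greedy X \<equiv> fold (\<lambda>e A. if e \<in> X \<and> \<pi> (indicator (insert e A)) \<ge> \<pi> (indicator A)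
                 then insert e A else A)"

lemma profit_le_greedy: "\<pi> (indicator A) \<le> \<pi> (indicator (greedy X es A))"
proof (induction es arbitrary: A)
  case (Cons e es)
  show ?case
    using Cons[of A] Cons[of "insert e A"] by auto
qed simp

text \<open>A zero-size item of \<open>X\<close> leaves the load unchanged and so always passes the
  profit test; the other steps never lower the profit. This serves the case of unbounded threshold
  parameters.\<close>

lemma greedy_zero_size:
  assumes "distinct es" "set es \<subseteq> {..<n}" "A \<inter> set es = {}"
  shows "\<pi> (indicator A) + (\<Sum>e | e \<in> set es \<and> e \<in> X \<and> s e = (\<lambda>_. 0). v e) \<le> \<pi> (indicator (greedy X es A))"
  using assms
proof (induction es arbitrary: A)
  case (Cons e es)
  have IH1: "\<pi> (indicator A) + (\<Sum>e | e \<in> set es \<and> e \<in> X \<and> s e = (\<lambda>_. 0). v e) \<le> \<pi> (indicator (greedy X es A))"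
    using Cons by (intro Cons.IH) auto
  have IH2: "\<pi> (indicator (insert e A)) + (\<Sum>e | e \<in> set es \<and> e \<in> X \<and> s e = (\<lambda>_. 0). v e)
      \<le> \<pi> (indicator (greedy X es (insert e A)))"
    using Cons by (intro Cons.IH) auto
  show ?case
  proof (cases "e \<in> X \<and> s e = (\<lambda>_. 0)")
    case True
    then have eq: "{k. k \<in> set (e # es) \<and> k \<in> X \<and> s k = (\<lambda>_. 0)}
        = insert e {k. k \<in> set es \<and> k \<in> X \<and> s k = (\<lambda>_. 0)}" by auto
    have "\<pi> (indicator (insert e A)) = \<pi> (indicator A) + v e"
      using profit_insert[of e A] Cons.prems True by simp
    moreover have "0 \<le> v e" using Cons.prems value_nonneg by simp
    ultimately show ?thesis
      using IH2 True Cons.prems unfolding eq by simp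
  next
    case False
    then have "{k. k \<in> set (e # es) \<and> k \<in> X \<and> s k = (\<lambda>_. 0)}
        = {k. k \<in> set es \<and> k \<in> X \<and> s k = (\<lambda>_. 0)}" by auto
    then show ?thesis using IH1 IH2 by auto
  qed
qed simp

text \<open>Some fraction of \<open>e\<close> brings the load to the crossing point, where the
  profit is at least \<open>c\<close> because every item involved is worth its
  \<open>\<mu>\<close>-price. By subadditivity that fraction accounts for at most \<open>M\<close>,
  so \<open>A\<close> alone suffices, whatever happens to \<open>e\<close>.\<close>

lemma greedy_crossing:
  assumes A: "A \<subseteq> {..<n}" "e < n" "e \<notin> A"
    and dense: "\<And>k. k \<in> insert e A \<Longrightarrow> dot d \<mu> (s k) \<le> v k"
    and below: "\<And>i. i < d \<Longrightarrow> grad d g (load n s (indicator A)) i \<le> \<mu> i"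
    and above: "i < d" "\<mu> i < grad d g (load n s (indicator (insert e A))) i"
    and conj: "\<And>i. i < d \<Longrightarrow> c \<le> gi_star g i (\<mu> i)"
    and cap: "\<And>t. 0 \<le> t \<Longrightarrow> t \<le> 1 \<Longrightarrow> \<pi> (only_item e t) \<le> M"
  shows "c - M \<le> \<pi> (indicator A)"
proof -
  let ?y = "load n s (indicator A)"
  have y: "?y \<in> orthant d" by (rule load_in_orthant) simp
  obtain \<theta> i where \<theta>: "0 \<le> \<theta>" "\<theta> \<le> 1" "i < d"
    "gi_star g i (\<mu> i) \<le> dot d \<mu> (\<lambda>i. ?y i + \<theta> * s e i) - g (\<lambda>i. ?y i + \<theta> * s e i)"
    using gradient_crossing[OF y size_in_orthant[OF A(2)] below, of i] above
    by (auto simp: load_insert[OF A(3,2)])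
  define x where "x = (\<lambda>k. indicator A k + only_item e \<theta> k)"
  have load: "load n s x = (\<lambda>i. ?y i + \<theta> * s e i)"
    using A by (simp add: x_def load_add load_only_item)
  have "c \<le> dot d \<mu> (load n s x) - g (load n s x)" using \<theta> conj[of i] by (simp add: load)
  also have "dot d \<mu> (load n s x) \<le> (\<Sum>k<n. v k * x k)"
    unfolding dot_load
  proof (rule sum_mono)
    fix k
    have "x k = 0 \<or> k \<in> insert e A" by (auto simp: x_def only_item_def indicator_def)
    moreover have "0 \<le> x k" using \<theta> by (simp add: x_def only_item_nonneg)
    ultimately show "dot d \<mu> (s k) * x k \<le> v k * x k"
      using dense[of k] by (auto intro: mult_right_mono)
  qed
  also have "(\<Sum>k<n. v k * x k) - g (load n s x) = \<pi> x" by (simp add: profit_def)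
  also have "\<pi> x \<le> \<pi> (indicator A) + \<pi> (only_item e \<theta>)"
    unfolding x_def using \<theta> by (intro profit_subadditive) (auto simp: only_item_nonneg)
  also have "\<pi> (only_item e \<theta>) \<le> M" using \<theta> by (intro cap)
  finally show ?thesis by simp
qed

text \<open>By the tangent at the load after insertion, the extra cost is at most gradient times
  size, hence at most the \<open>\<mu>\<close>-price of \<open>e\<close>, which its value
  covers.\<close>

lemma greedy_accepts:
  assumes A: "e < n" "e \<notin> A" and dense: "dot d \<mu> (s e) \<le> v e"
    and below: "\<And>i. i < d \<Longrightarrow> grad d g (load n s (indicator (insert e A))) i \<le> \<mu> i"
  shows "\<pi> (indicator A) \<le> \<pi> (indicator (insert e A))"
proof -
  let ?y = "load n s (indicator A)" and ?y' = "load n s (indicator (insert e A))"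
  have y: "?y \<in> orthant d" "?y' \<in> orthant d" by (rule load_in_orthant, simp)+
  have y': "?y' = (\<lambda>i. ?y i + s e i)" by (rule load_insert[OF A(2,1)])
  have "g ?y' + dot d (grad d g ?y') (\<lambda>i. ?y i - ?y' i) \<le> g ?y"
    by (intro gradient_inequality y)
  moreover have "dot d (grad d g ?y') (\<lambda>i. ?y i - ?y' i) = - dot d (grad d g ?y') (s e)"
    by (simp add: y' dot_minus_right)
  moreover have "dot d (grad d g ?y') (s e) \<le> dot d \<mu> (s e)"
    using below size_in_orthant[OF A(1)] by (rule dot_mono_left)
  ultimately show ?thesis
    using dense profit_insert[OF A(2,1)] by (simp add: y')
qed

text \<open>The gradient bound is the invariant. While it survives insertions, every item of
  \<open>X\<close> is accepted; its first violation gives the profit bound, which later steps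
  preserve.\<close>

lemma greedy_alternative:
  assumes "distinct es" "set es \<subseteq> {..<n}" "A \<subseteq> {..<n}" "A \<inter> set es = {}"
    and "\<And>k. k \<in> A \<union> (X \<inter> set es) \<Longrightarrow> dot d \<mu> (s k) \<le> v k"
    and "\<And>i. i < d \<Longrightarrow> grad d g (load n s (indicator A)) i \<le> \<mu> i"
    and conj: "\<And>i. i < d \<Longrightarrow> c \<le> gi_star g i (\<mu> i)"
    and cap: "\<And>e t. e < n \<Longrightarrow> 0 \<le> t \<Longrightarrow> t \<le> 1 \<Longrightarrow> \<pi> (only_item e t) \<le> M"
  shows "c - M \<le> \<pi> (indicator (greedy X es A)) \<or>
     greedy X es A = A \<union> (X \<inter> set es) \<and>
     (\<forall>i<d. grad d g (load n s (indicator (A \<union> (X \<inter> set es)))) i \<le> \<mu> i)"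
  using assms(1-6)
proof (induction es arbitrary: A)
  case (Cons e es)
  have e: "e < n" "e \<notin> A" "e \<notin> set es" using Cons.prems by auto
  show ?case
  proof (cases "e \<in> X")
    case False
    then have eq: "X \<inter> set (e # es) = X \<inter> set es" by auto
    have "c - M \<le> \<pi> (indicator (greedy X es A)) \<or>
     greedy X es A = A \<union> (X \<inter> set es) \<and>
     (\<forall>i<d. grad d g (load n s (indicator (A \<union> (X \<inter> set es)))) i \<le> \<mu> i)"
      using Cons.prems by (intro Cons.IH) auto
    then show ?thesis using False unfolding eq by simp
  next
    case True
    then have eq: "A \<union> (X \<inter> set (e # es)) = insert e A \<union> (X \<inter> set es)" by auto
    have dense: "dot d \<mu> (s k) \<le> v k" if "k \<in> insert e A" for k
      using that True by (intro Cons.prems) auto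
    show ?thesis
    proof (cases "\<forall>i<d. grad d g (load n s (indicator (insert e A))) i \<le> \<mu> i")
      case below: True
      have "c - M \<le> \<pi> (indicator (greedy X es (insert e A))) \<or>
        greedy X es (insert e A) = insert e A \<union> (X \<inter> set es) \<and>
        (\<forall>i<d. grad d g (load n s (indicator (insert e A \<union> (X \<inter> set es)))) i \<le> \<mu> i)"
        using Cons.prems below e True by (intro Cons.IH) auto
      moreover have "\<pi> (indicator A) \<le> \<pi> (indicator (insert e A))"
        using e dense below by (intro greedy_accepts) auto
      ultimately show ?thesis using True unfolding eq by simp
    next
      case False
      then obtain i where "i < d" "\<mu> i < grad d g (load n s (indicator (insert e A))) i"
        by (auto simp: not_le)
      then have "c - M \<le> \<pi> (indicator A)"
        using Cons.prems e dense conj cap by (intro greedy_crossing[of A e \<mu> i c M]) auto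
      also have "\<dots> \<le> \<pi> (indicator (greedy X (e # es) A))" by (rule profit_le_greedy)
      finally show ?thesis by simp
    qed
  qed
qed simp

text \<open>Removing a fractional part \<open>z\<close> saves at most its
  \<open>\<mu>\<close>-price, by the tangent at the full load, and loses at least that much
  value.\<close>

lemma fopt_le_profit_all:
  assumes A: "A \<subseteq> {..<n}" and dense: "\<And>k. k \<in> A \<Longrightarrow> dot d \<mu> (s k) \<le> v k"
    and below: "\<And>i. i < d \<Longrightarrow> grad d g (load n s (indicator A)) i \<le> \<mu> i"
  shows "fo A \<le> \<pi> (indicator A)"
proof (rule fopt_least)
  fix x assume x: "x \<in> fractional A"
  let ?y = "load n s (indicator A)"
  define z where "z = (\<lambda>e. indicator A e - x e)"
  have z: "0 \<le> z e" for e
    using fractionalD[OF x, of e] by (auto simp: z_def indicator_def)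
  have ind: "indicator A = (\<lambda>e. x e + z e)" by (auto simp: z_def)
  have y: "?y = (\<lambda>i. load n s x i + load n s z i)" unfolding ind by (rule load_add)
  have "g ?y + dot d (grad d g ?y) (\<lambda>i. load n s x i - ?y i) \<le> g (load n s x)"
    using fractionalD[OF x] by (intro gradient_inequality load_in_orthant) auto
  moreover have "dot d (grad d g ?y) (\<lambda>i. load n s x i - ?y i) = - dot d (grad d g ?y) (load n s z)"
    by (simp add: y dot_minus_right)
  moreover have "dot d (grad d g ?y) (load n s z) \<le> dot d \<mu> (load n s z)"
    using below load_in_orthant[of z] z by (intro dot_mono_left) auto
  moreover have "dot d \<mu> (load n s z) \<le> (\<Sum>e<n. v e * z e)"
    unfolding dot_load
  proof (rule sum_mono)
    fix k
    have "z k = 0 \<or> k \<in> A" using fractionalD(3)[OF x, of k] by (auto simp: z_def)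
    then show "dot d \<mu> (s k) * z k \<le> v k * z k"
      using dense[of k] z[of k] by (auto intro: mult_right_mono)
  qed
  moreover have "(\<Sum>e<n. v e * indicator A e) = (\<Sum>e<n. v e * x e) + (\<Sum>e<n. v e * z e)"
    by (simp add: z_def algebra_simps flip: sum.distrib)
  ultimately show "\<pi> x \<le> \<pi> (indicator A)" by (simp add: profit_def)
qed

lemma fopt_zero_size:
  assumes A: "A \<subseteq> {..<n}" and zero: "\<And>e. e \<in> A \<Longrightarrow> s e = (\<lambda>_. 0)"
  shows "fo A \<le> (\<Sum>e\<in>A. v e)"
proof (rule fopt_least)
  fix x assume x: "x \<in> fractional A"
  have "\<pi> x \<le> (\<Sum>e<n. v e * x e)"
    using g_nonneg[OF load_in_orthant[of x]] fractionalD(1)[OF x] by (simp add: profit_def)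
  also have "\<dots> = (\<Sum>e\<in>A. v e * x e)"
    using A fractionalD(3)[OF x] by (intro sum.mono_neutral_right) auto
  also have "\<dots> \<le> (\<Sum>e\<in>A. v e)"
    using value_nonneg A fractionalD[OF x] by (intro sum_mono mult_left_le) auto
  finally show "\<pi> x \<le> (\<Sum>e\<in>A. v e)" .
qed

text \<open>Weak duality: replacing values by the larger \<open>\<mu>\<close>-prices bounds the
  profit by \<open>dot d \<mu> y - g y\<close> at the load \<open>y\<close>.\<close>

lemma fopt_le_conjugates:
  assumes "A \<subseteq> {..<n}" and sparse: "\<And>e. e \<in> A \<Longrightarrow> v e \<le> dot d \<mu> (s e)"
  shows "fo A \<le> (\<Sum>i<d. gi_star g i (\<mu> i))"
proof (rule fopt_least)
  fix x assume x: "x \<in> fractional A"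
  have "(\<Sum>e<n. v e * x e) \<le> dot d \<mu> (load n s x)"
    unfolding dot_load
  proof (rule sum_mono)
    fix k
    show "v k * x k \<le> dot d \<mu> (s k) * x k"
      using sparse[of k] fractionalD[OF x, of k] by (cases "k \<in> A") (auto intro: mult_right_mono)
  qed
  moreover have "load n s x \<in> orthant d" using fractionalD[OF x] by (intro load_in_orthant)
  ultimately show "\<pi> x \<le> (\<Sum>i<d. gi_star g i (\<mu> i))"
    using dot_le_conjugates[of "load n s x" \<mu>] by (simp add: profit_def)
qed

subsection \<open>The threshold chosen from the sample\<close>

lemma items_above_antimono:
  assumes "\<mu> \<le> \<mu>'" "X \<subseteq> {..<n}"
  shows "items_above d v s X \<mu>' \<subseteq> items_above d v s X \<mu>"
proof
  fix e assume e: "e \<in> items_above d v s X \<mu>'"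
  then have "dot d \<mu> (s e) \<le> dot d \<mu>' (s e)"
    using assms size_in_orthant[of e] by (intro dot_mono_left) (auto simp: items_above_def le_fun_def)
  then show "e \<in> items_above d v s X \<mu>" using e by (auto simp: items_above_def)
qed

text \<open>The sets above curve points form a chain, so a qualifying one of least cardinality is
  contained in all the others. The choice of \<open>W\<close> does not depend on the sample.\<close>

lemma common_core:
  assumes "a \<le> fo {..<n}"
  obtains W where "W \<subseteq> {..<n}" "a \<le> fo W"
    "\<And>\<tau>. 0 < \<tau> \<Longrightarrow> a \<le> fo (items_above d v s {..<n} (curve_point d g \<tau>))
       \<Longrightarrow> W \<subseteq> items_above d v s {..<n} (curve_point d g \<tau>)"
proof -
  let ?U = "\<lambda>\<tau>. items_above d v s {..<n} (curve_point d g \<tau>)"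
  let ?P = "\<lambda>\<tau>. 0 < \<tau> \<and> a \<le> fo (?U \<tau>)"
  have fin: "finite (?U \<tau>)" for \<tau> by (simp add: items_above_def)
  show ?thesis
  proof (cases "\<exists>\<tau>. ?P \<tau>")
    case False
    \<comment> \<open>If no parameter qualifies, the inclusion is vacuous and the whole universe
      serves.\<close>
    then show ?thesis using that[of "{..<n}"] assms by blast
  next
    case True
    then obtain \<tau>0 where \<tau>0: "?P \<tau>0" "\<And>\<tau>. ?P \<tau> \<Longrightarrow> card (?U \<tau>0) \<le> card (?U \<tau>)"
      using ex_has_least_nat[of ?P _ "\<lambda>\<tau>. card (?U \<tau>)"] by blast
    show ?thesis
    proof (rule that[of "?U \<tau>0"])
      fix \<tau> assume \<tau>: "0 < \<tau>" "a \<le> fo (?U \<tau>)"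
      show "?U \<tau>0 \<subseteq> ?U \<tau>"
      proof (cases "\<tau> \<le> \<tau>0")
        case True
        then show ?thesis using \<tau> by (intro items_above_antimono curve_point_mono) auto
      next
        case False
        then have "?U \<tau> \<subseteq> ?U \<tau>0" using \<tau>0 by (intro items_above_antimono curve_point_mono) auto
        then show ?thesis using card_seteq[OF fin] \<tau>0(2) \<tau> by blast
      qed
    qed (use \<tau>0 in \<open>auto simp: items_above_def\<close>)
  qed
qed

text \<open>This bounds the loss caused by the strict acceptance test: in general position at most
  one item lies exactly on the threshold.\<close>

lemma fopt_subsingleton:
  assumes A: "A \<subseteq> {..<n}" "\<And>e e'. e \<in> A \<Longrightarrow> e' \<in> A \<Longrightarrow> e = e'" and M: "0 \<le> M"
    and cap: "\<And>e t. e < n \<Longrightarrow> 0 \<le> t \<Longrightarrow> t \<le> 1 \<Longrightarrow> \<pi> (only_item e t) \<le> M"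
  shows "fo A \<le> M"
proof (rule fopt_least)
  fix x assume x: "x \<in> fractional A"
  show "\<pi> x \<le> M"
  proof (cases "A = {}")
    case True
    then have "x = (\<lambda>_. 0)" using x by (auto simp: fractional_def)
    then show ?thesis using M by simp
  next
    case False
    then obtain e where e: "e \<in> A" by blast
    have "x = only_item e (x e)"
    proof
      fix k
      show "x k = only_item e (x e) k"
        using fractionalD(3)[OF x, of k] A(2)[OF _ e, of k] by (auto simp: only_item_def)
    qed
    moreover have "\<pi> (only_item e (x e)) \<le> M"
      using cap[of e] e A fractionalD[OF x] by auto
    ultimately show ?thesis by simp
  qed
qed

text \<open>Items below the curve point contribute at most \<open>d * \<tau>\<close>, so by
  subadditivity the items above it keep 1/12 of \<open>fo L\<close>, and hence the fraction
  \<open>1 / (12 * d)\<close>.\<close>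

lemma good_of_small_dual:
  assumes d: "1 \<le> d" and L: "L \<subseteq> {..<n}" and \<tau>: "0 < \<tau>" "real d * \<tau> \<le> 11 / 12 * fo L"
  shows "1 / (12 * real d) * fo L \<le> fo (items_above d v s L (curve_point d g \<tau>))"
proof -
  let ?A = "items_above d v s L (curve_point d g \<tau>)"
  have "fo (L - ?A) \<le> (\<Sum>i<d. gi_star g i (curve_point d g \<tau> i))"
    using L by (intro fopt_le_conjugates) (auto simp: items_above_def)
  also have "\<dots> = real d * \<tau>" using \<tau> by (simp add: gi_star_curve_point)
  finally have "fo (L - ?A) \<le> 11 / 12 * fo L" using \<tau> by simp
  moreover have "L \<inter> ?A = ?A" by (auto simp: items_above_def)
  ultimately have "1 / 12 * fo L \<le> fo ?A" using fopt_subadditive[of L ?A] by simp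
  moreover have "1 / (12 * real d) * fo L \<le> 1 / 12 * fo L"
    using d fopt_nonneg[of L] by (intro mult_right_mono) (auto simp: field_simps)
  ultimately show ?thesis by linarith
qed

text \<open>Finitely many items of \<open>L\<close> are below the threshold at the supremum, and by
  left continuity they are already below it at all close enough smaller parameters. A good parameter
  that close has no items above it beyond those at the supremum.\<close>

lemma good_set_closed:
  assumes L: "L \<subseteq> {..<n}"
    and T: "T = {\<tau>. 0 < \<tau> \<and> c \<le> fo (items_above d v s L (curve_point d g \<tau>))}"
    and bdd: "bdd_above T" and \<tau>0: "\<tau>0 \<in> T"
  shows "Sup T \<in> T"
proof -
  let ?t = "Sup T"
  let ?l = "curve_point d g"
  have t: "0 < ?t" using cSup_upper[OF \<tau>0 bdd] \<tau>0 by (simp add: T)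
  define E where "E = {e\<in>L. v e < dot d (?l ?t) (s e)}"
  have "finite E" using finite_subset[OF L] by (simp add: E_def)
  have "\<exists>r<?t. \<forall>\<tau>. 0 < \<tau> \<longrightarrow> r < \<tau> \<longrightarrow> v e < dot d (?l \<tau>) (s e)" if "e \<in> E" for e
  proof -
    have "s e \<in> orthant d" "v e < dot d (?l ?t) (s e)"
      using that L size_in_orthant by (auto simp: E_def)
    then show ?thesis using dot_curve_point_left_limit[OF t] by metis
  qed
  then obtain r where r: "\<And>e. e \<in> E \<Longrightarrow> r e < ?t"
    "\<And>e \<tau>. e \<in> E \<Longrightarrow> 0 < \<tau> \<Longrightarrow> r e < \<tau> \<Longrightarrow> v e < dot d (?l \<tau>) (s e)"
    by metis
  define \<rho> where "\<rho> = Max (insert 0 (r ` E))"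
  have "\<rho> < ?t" using r t \<open>finite E\<close> by (simp add: \<rho>_def)
  then obtain \<tau> where \<tau>: "\<tau> \<in> T" "\<rho> < \<tau>"
    using less_cSup_iff[OF _ bdd] \<tau>0 by blast
  have "items_above d v s L (?l \<tau>) \<subseteq> items_above d v s L (?l ?t)"
  proof
    fix e assume e: "e \<in> items_above d v s L (?l \<tau>)"
    have "e \<notin> E"
    proof
      assume "e \<in> E"
      then have "r e < \<tau>" using \<tau> \<open>finite E\<close> by (auto simp: \<rho>_def)
      then show False using r(2)[OF \<open>e \<in> E\<close>] \<tau> e by (force simp: items_above_def T)
    qed
    then show "e \<in> items_above d v s L (?l ?t)" using e by (auto simp: items_above_def E_def)
  qed
  then have "fo (items_above d v s L (?l \<tau>)) \<le> fo (items_above d v s L (?l ?t))" by (rule fopt_mono)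
  moreover have "c \<le> fo (items_above d v s L (?l \<tau>))" using \<tau> by (simp add: T)
  ultimately have "c \<le> fo (items_above d v s L (?l ?t))" by linarith
  then show ?thesis using t by (subst (2) T) simp
qed

text \<open>Path points lie below the whole curve, so only curve points compete, and these are
  ordered by their parameter.\<close>

lemma largest_threshold_Sup:
  assumes C: "threshold_curve d g \<C>" and L: "L \<subseteq> {..<n}"
    and T: "T = {\<tau>. 0 < \<tau> \<and> 1 / (12 * real d) * fo L \<le> fo (items_above d v s L (curve_point d g \<tau>))}"
    and bdd: "bdd_above T" and \<tau>0: "\<tau>0 \<in> T"
  shows "largest_threshold d n v s g \<C> L (curve_point d g (Sup T))"
proof -
  have t: "Sup T \<in> T" by (rule good_set_closed[OF L T bdd \<tau>0])
  show ?thesis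
    unfolding largest_threshold_def Let_def
  proof (intro conjI ballI)
    show "curve_point d g (Sup T) \<in> {\<mu> \<in> \<C>. 1 / (12 * real d) * fo L \<le> fo (items_above d v s L \<mu>)}"
      using t curve_point_in_curve[OF C] by (auto simp: T)
    fix \<mu> assume \<mu>: "\<mu> \<in> {\<mu> \<in> \<C>. 1 / (12 * real d) * fo L \<le> fo (items_above d v s L \<mu>)}"
    then have "\<mu> \<in> \<C>" by simp
    with C show "\<mu> \<le> curve_point d g (Sup T)"
    proof (cases rule: threshold_curve_cases)
      case (curve \<tau>)
      then have "\<tau> \<in> T" using \<mu> by (simp add: T)
      then show ?thesis using curve cSup_upper[OF _ bdd] by (simp add: curve_point_mono)
    next
      case path
      then show ?thesis using t by (simp add: T)
    qed
  qed
qed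

text \<open>Every coordinate of the curve grows without bound, so an item of positive size in some
  coordinate is eventually priced above its value.\<close>

lemma unbounded_curve_zero_size:
  assumes e: "e < n" and T: "\<not> bdd_above T"
    and above: "\<And>\<tau>. \<tau> \<in> T \<Longrightarrow> 0 < \<tau> \<and> dot d (curve_point d g \<tau>) (s e) \<le> v e"
  shows "s e = (\<lambda>_. 0)"
proof (rule ccontr)
  assume "s e \<noteq> (\<lambda>_. 0)"
  then obtain i where i: "s e i \<noteq> 0" by auto
  then have "i < d" using size_in_orthant[OF e] by (force simp: orthant_def vecs_def not_less[symmetric])
  have pos: "0 < s e i" using i orthant_nonneg[OF size_in_orthant[OF e], of i] by simp
  define u where "u = (v e + 1) / s e i"
  obtain \<tau> where \<tau>: "\<tau> \<in> T" "gi_star g i u < \<tau>"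
    using T unfolding bdd_above_def by (meson not_le)
  have "u < curve_point d g \<tau> i" using above \<tau> \<open>i < d\<close> by (intro le_curve_point) auto
  then have "u * s e i < curve_point d g \<tau> i * s e i" using pos by simp
  then have "v e + 1 < curve_point d g \<tau> i * s e i" using pos by (simp add: u_def)
  also have "\<dots> \<le> dot d (curve_point d g \<tau>) (s e)"
    unfolding dot_def
    using \<open>i < d\<close> above[OF \<tau>(1)] orthant_nonneg[OF size_in_orthant[OF e]]
      orthant_nonneg[OF curve_point_in_orthant]
    by (intro member_le_sum[where f = "\<lambda>i. curve_point d g \<tau> i * s e i"]) auto
  finally show False using above[OF \<tau>(1)] by simp
qed

text \<open>The deterministic part of the analysis. The sample enters only through the lower bounds
  on \<open>fo L\<close> and on \<open>fo (set R \<inter> W)\<close>.\<close>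

lemma greedy_profit:
  assumes d: "1 \<le> d" and C: "threshold_curve d g \<C>" and m: "threshold_rule d n v s g \<C> m"
    and gp: "general_position d n v s"
    and L: "L \<subseteq> {..<n}" and R: "distinct R" "set R = {..<n} - L"
    and opt: "0 < opt n v s g" and fL: "opt n v s g / 4 \<le> fo L"
    and cap: "\<And>e t. e < n \<Longrightarrow> 0 \<le> t \<Longrightarrow> t \<le> 1 \<Longrightarrow> \<pi> (only_item e t) \<le> opt n v s g / (10 ^ 4 * real d)"
    and W: "\<And>\<tau>. 0 < \<tau> \<Longrightarrow> opt n v s g / (48 * real d) \<le> fo (items_above d v s {..<n} (curve_point d g \<tau>))
       \<Longrightarrow> W \<subseteq> items_above d v s {..<n} (curve_point d g \<tau>)"
    and fR: "opt n v s g / (200 * real d) \<le> fo (set R \<inter> W)"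
  shows "opt n v s g / (400 * real d)
     \<le> \<pi> (indicator (greedy (items_strictly_above d v s (set R) (m L)) R {}))"
proof -
  define q where "q = opt n v s g / real d"
  have q: "0 < q" using opt d by (simp add: q_def)
  let ?X = "items_strictly_above d v s (set R) (m L)"
  define T where "T = {\<tau>. 0 < \<tau> \<and> 1 / (12 * real d) * fo L \<le> fo (items_above d v s L (curve_point d g \<tau>))}"
  \<comment> \<open>\<open>opt / (48 * d)\<close> is the fraction \<open>1 / (12 * d)\<close> of the
    guaranteed \<open>opt / 4\<close>, so every good parameter of the sample is subject to
    \<open>W\<close>.\<close>
  have W_le: "W \<subseteq> items_above d v s {..<n} (curve_point d g \<tau>)" if "\<tau> \<in> T" for \<tau>
  proof (rule W)
    have "opt n v s g / (48 * real d) = 1 / (12 * real d) * (opt n v s g / 4)" by simp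
    also have "\<dots> \<le> 1 / (12 * real d) * fo L" using fL by (intro mult_left_mono) auto
    also have "\<dots> \<le> fo (items_above d v s L (curve_point d g \<tau>))" using that by (simp add: T_def)
    also have "\<dots> \<le> fo (items_above d v s {..<n} (curve_point d g \<tau>))"
      using L by (intro fopt_mono) (auto simp: items_above_def)
    finally show "opt n v s g / (48 * real d) \<le> fo (items_above d v s {..<n} (curve_point d g \<tau>))" .
  qed (use that in \<open>simp add: T_def\<close>)
  \<comment> \<open>11/48 is 11/12 times 1/4, the parameter that \<open>good_of_small_dual\<close>
    certifies when \<open>fo L\<close> is \<open>opt / 4\<close>.\<close>
  define b where "b = 11 / 48 * q"
  have b: "0 < b" using q by (simp add: b_def)
  have "b \<in> T"
  proof -
    have "real d * b = 11 / 12 * (opt n v s g / 4)" using d by (simp add: b_def q_def)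
    also have "\<dots> \<le> 11 / 12 * fo L" using fL by simp
    finally show ?thesis using good_of_small_dual[OF d L b] b by (simp add: T_def)
  qed
  have "q / 400 \<le> \<pi> (indicator (greedy ?X R {}))"
  proof (cases "bdd_above T")
    case True
    define t where "t = Sup T"
    have "largest_threshold d n v s g \<C> L (curve_point d g t)"
      unfolding t_def by (rule largest_threshold_Sup[OF C L T_def True \<open>b \<in> T\<close>])
    moreover from this have "largest_threshold d n v s g \<C> L (m L)"
      using m L unfolding threshold_rule_def by blast
    ultimately have mu: "m L = curve_point d g t"
      unfolding largest_threshold_def Let_def by (meson antisym)
    have "t \<in> T" unfolding t_def by (rule good_set_closed[OF L T_def True \<open>b \<in> T\<close>])
    have bt: "b \<le> t" using cSup_upper[OF \<open>b \<in> T\<close> True] by (simp add: t_def)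
    have "0 < t" using b bt by simp
    have XR: "?X \<inter> set R = ?X" by (auto simp: items_strictly_above_def)
    have dense: "dot d (m L) (s k) \<le> v k" if "k \<in> ?X" for k
      using that by (auto simp: items_strictly_above_def)
    have "t - q / 10 ^ 4 \<le> \<pi> (indicator (greedy ?X R {})) \<or>
       greedy ?X R {} = {} \<union> (?X \<inter> set R) \<and>
       (\<forall>i<d. grad d g (load n s (indicator ({} \<union> (?X \<inter> set R)))) i \<le> m L i)"
    proof (rule greedy_alternative)
      show "grad d g (load n s (indicator {})) i \<le> m L i" if "i < d" for i
        using gi_star_pos_imp(1)[OF that, of "m L i"] gi_star_curve_point[OF \<open>0 < t\<close> that] \<open>0 < t\<close>
        by (simp add: mu load_def)
      show "t \<le> gi_star g i (m L i)" if "i < d" for i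
        using gi_star_curve_point[OF \<open>0 < t\<close> that] by (simp add: mu)
    qed (use R cap dense in \<open>auto simp: q_def mult.commute\<close>)
    then show ?thesis
    proof
      assume "t - q / 10 ^ 4 \<le> \<pi> (indicator (greedy ?X R {}))"
      then show ?thesis using bt q by (simp add: b_def)
    next
      assume *: "greedy ?X R {} = {} \<union> (?X \<inter> set R) \<and>
       (\<forall>i<d. grad d g (load n s (indicator ({} \<union> (?X \<inter> set R)))) i \<le> m L i)"
      have "fo (set R \<inter> W) \<le> fo (set R \<inter> W \<inter> ?X) + fo (set R \<inter> W - ?X)"
        by (rule fopt_subadditive)
      also have "fo (set R \<inter> W \<inter> ?X) \<le> fo ?X" by (intro fopt_mono) auto
      also have "fo ?X \<le> \<pi> (indicator ?X)"
      proof (rule fopt_le_profit_all[OF _ dense])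
        show "?X \<subseteq> {..<n}" using R by (auto simp: items_strictly_above_def)
        show "grad d g (load n s (indicator ?X)) i \<le> m L i" if "i < d" for i
          using * that unfolding XR by simp
      qed
      \<comment> \<open>Items of \<open>W\<close> have value at least their price at the threshold,
        so those missing from \<open>?X\<close> lie exactly on it, and general position allows at
        most one.\<close>
      also have "fo (set R \<inter> W - ?X) \<le> q / 10 ^ 4"
      proof (rule fopt_subsingleton)
        have on_threshold: "v e = dot d (m L) (s e)" if "e \<in> set R \<inter> W - ?X" for e
          using that W_le[OF \<open>t \<in> T\<close>] unfolding mu items_above_def items_strictly_above_def by force
        have "m L \<in> orthant d" unfolding mu by (rule curve_point_in_orthant[OF \<open>0 < t\<close>])
        then show "e = e'" if "e \<in> set R \<inter> W - ?X" "e' \<in> set R \<inter> W - ?X" for e e'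
          using gp on_threshold[OF that(1)] on_threshold[OF that(2)] that R
          unfolding general_position_def by blast
      qed (use R cap q in \<open>auto simp: q_def mult.commute\<close>)
      finally have "q / 200 - q / 10 ^ 4 \<le> \<pi> (indicator ?X)" using fR by (simp add: q_def)
      moreover have "greedy ?X R {} = ?X" using * XR by simp
      ultimately show ?thesis using q by simp
    qed
  next
    case False
    \<comment> \<open>The remaining items of \<open>W\<close> lie above arbitrarily high thresholds.
      Being of size zero they have price 0 under any vector, so the argument holds for every value
      of \<open>m L\<close>.\<close>
    have zero: "s e = (\<lambda>_. 0)" if "e \<in> set R \<inter> W" for e
    proof (rule unbounded_curve_zero_size[OF _ False])
      show "e < n" using that R by auto
      show "0 < \<tau> \<and> dot d (curve_point d g \<tau>) (s e) \<le> v e" if "\<tau> \<in> T" for \<tau>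
        using W_le[OF that] \<open>e \<in> set R \<inter> W\<close> that by (auto simp: items_above_def T_def)
    qed
    have "q / 200 \<le> fo (set R \<inter> W)" using fR by (simp add: q_def)
    also have "\<dots> \<le> (\<Sum>e\<in>set R \<inter> W. v e)" using R zero by (intro fopt_zero_size) auto
    \<comment> \<open>Zero-size items of value 0 fail the strict test, so they are dropped
      first.\<close>
    also have "\<dots> = (\<Sum>e | e \<in> set R \<inter> W \<and> 0 < v e. v e)"
      using R value_nonneg by (intro sum.mono_neutral_right) (auto, force)
    also have "\<dots> \<le> (\<Sum>e | e \<in> set R \<and> e \<in> ?X \<and> s e = (\<lambda>_. 0). v e)"
    proof (rule sum_mono2)
      show "{e. e \<in> set R \<inter> W \<and> 0 < v e} \<subseteq> {e. e \<in> set R \<and> e \<in> ?X \<and> s e = (\<lambda>_. 0)}"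
      proof
        fix e assume "e \<in> {e. e \<in> set R \<inter> W \<and> 0 < v e}"
        then show "e \<in> {e. e \<in> set R \<and> e \<in> ?X \<and> s e = (\<lambda>_. 0)}"
          using zero[of e] by (simp add: items_strictly_above_def dot_def)
      qed
      show "0 \<le> v e"
        if "e \<in> {e. e \<in> set R \<and> e \<in> ?X \<and> s e = (\<lambda>_. 0)} - {e. e \<in> set R \<inter> W \<and> 0 < v e}" for e
        using that R value_nonneg[of e] by simp
    qed simp
    also have "\<dots> \<le> \<pi> (indicator (greedy ?X R {}))"
      using greedy_zero_size[of R "{}" ?X] R by simp
    finally show ?thesis using q by simp
  qed
  then show ?thesis by (simp add: q_def)
qed

end

section \<open>The random sample\<close>

text \<open>\<open>2 * sum a A - sum a S\<close> is the sum of the \<open>a e\<close> with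
  independent random signs, and this is its variance times the number of subsets. In the induction
  step the mixed terms for the two signs of \<open>a x\<close> cancel.\<close>

lemma sum_Pow_deviation_sq:
  fixes a :: "'a \<Rightarrow> real"
  assumes "finite S"
  shows "(\<Sum>A\<in>Pow S. (2 * sum a A - sum a S)\<^sup>2) = 2 ^ card S * (\<Sum>e\<in>S. (a e)\<^sup>2)"
  using assms
proof (induction S)
  case (insert x S)
  let ?D = "\<lambda>A. 2 * sum a A - sum a S"
  have fin: "finite A" if "A \<in> Pow S" for A using that insert by (auto intro: finite_subset)
  have "(\<Sum>A\<in>Pow (insert x S). (2 * sum a A - sum a (insert x S))\<^sup>2)
      = (\<Sum>A\<in>Pow S. (2 * sum a A - sum a (insert x S))\<^sup>2)
      + (\<Sum>A\<in>insert x ` Pow S. (2 * sum a A - sum a (insert x S))\<^sup>2)"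
    unfolding Pow_insert using insert by (intro sum.union_disjoint) auto
  also have "(\<Sum>A\<in>insert x ` Pow S. (2 * sum a A - sum a (insert x S))\<^sup>2)
      = (\<Sum>A\<in>Pow S. (2 * sum a (insert x A) - sum a (insert x S))\<^sup>2)"
    using insert by (subst sum.reindex) (auto simp: inj_on_def)
  also have "\<dots> = (\<Sum>A\<in>Pow S. (?D A + a x)\<^sup>2)"
    using insert fin by (intro sum.cong refl arg_cong[of _ _ power2]) (subst sum.insert, auto)
  also have "(\<Sum>A\<in>Pow S. (2 * sum a A - sum a (insert x S))\<^sup>2) = (\<Sum>A\<in>Pow S. (?D A - a x)\<^sup>2)"
    using insert by (intro sum.cong refl arg_cong[of _ _ power2]) simp
  also have "(\<Sum>A\<in>Pow S. (?D A - a x)\<^sup>2) + (\<Sum>A\<in>Pow S. (?D A + a x)\<^sup>2)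
      = (\<Sum>A\<in>Pow S. 2 * (?D A)\<^sup>2 + 2 * (a x)\<^sup>2)"
    unfolding sum.distrib[symmetric] by (intro sum.cong refl) (simp add: power2_eq_square algebra_simps)
  also have "\<dots> = 2 * (2 ^ card S * (\<Sum>e\<in>S. (a e)\<^sup>2)) + 2 ^ card S * (2 * (a x)\<^sup>2)"
    using insert by (simp add: sum.distrib card_Pow flip: sum_distrib_left)
  also have "\<dots> = 2 ^ card (insert x S) * (\<Sum>e\<in>insert x S. (a e)\<^sup>2)"
    using insert by (simp add: algebra_simps)
  finally show ?case .
qed simp

text \<open>Chebyshev's inequality by counting: an unbalanced subset deviates by at least half the
  total, while the cap \<open>M\<close> bounds the variance by \<open>M\<close> times the
  total.\<close>

lemma card_unbalanced_subsets:
  fixes a :: "'a \<Rightarrow> real"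
  assumes S: "finite S" and a: "\<And>e. 0 \<le> a e" "\<And>e. a e \<le> M" and F: "0 < F" "F \<le> sum a S"
  shows "F * real (card {A \<in> Pow S. sum a A < F / 4 \<or> sum a (S - A) < F / 4}) \<le> 4 * M * 2 ^ card S"
proof -
  let ?B = "{A \<in> Pow S. sum a A < F / 4 \<or> sum a (S - A) < F / 4}"
  let ?F = "sum a S"
  have "?F\<^sup>2 / 4 \<le> (2 * sum a A - ?F)\<^sup>2" if "A \<in> ?B" for A
  proof -
    have "sum a (S - A) = ?F - sum a A" using that S by (simp add: sum_diff)
    then have "?F / 2 \<le> \<bar>2 * sum a A - ?F\<bar>" using that F by auto
    then have "(?F / 2)\<^sup>2 \<le> \<bar>2 * sum a A - ?F\<bar>\<^sup>2" using F by (intro power_mono) auto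
    then show ?thesis by (simp add: power_divide)
  qed
  then have "(\<Sum>A\<in>?B. ?F\<^sup>2 / 4) \<le> (\<Sum>A\<in>?B. (2 * sum a A - ?F)\<^sup>2)" by (intro sum_mono)
  also have "\<dots> \<le> (\<Sum>A\<in>Pow S. (2 * sum a A - ?F)\<^sup>2)"
    using S by (intro sum_mono2) auto
  also have "\<dots> = 2 ^ card S * (\<Sum>e\<in>S. (a e)\<^sup>2)" by (rule sum_Pow_deviation_sq[OF S])
  also have "(\<Sum>e\<in>S. (a e)\<^sup>2) \<le> (\<Sum>e\<in>S. M * a e)"
    using a by (intro sum_mono) (simp add: power2_eq_square mult_right_mono)
  also have "(\<Sum>e\<in>S. M * a e) = M * ?F" by (simp add: sum_distrib_left)
  finally have "?F * (?F * real (card ?B)) \<le> ?F * (4 * M * 2 ^ card S)"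
    by (simp add: power2_eq_square algebra_simps)
  then have "?F * real (card ?B) \<le> 4 * M * 2 ^ card S"
    using F by (subst (asm) mult_le_cancel_left_pos) auto
  moreover have "F * real (card ?B) \<le> ?F * real (card ?B)" using F by (intro mult_right_mono) auto
  ultimately show ?thesis by linarith
qed

section \<open>Uniformity of the sample\<close>

lemma card_permutations_with_prefix_set:
  assumes S: "finite S" and A: "A \<subseteq> S"
  shows "card {es \<in> permutations_of_set S. set (take (card A) es) = A} = fact (card A) * fact (card (S - A))"
proof -
  let ?P = "permutations_of_set A \<times> permutations_of_set (S - A)"
  have "{es \<in> permutations_of_set S. set (take (card A) es) = A} = (\<lambda>(xs, ys). xs @ ys) ` ?P"
  proof (intro set_eqI iffI)
    fix es assume es: "es \<in> {es \<in> permutations_of_set S. set (take (card A) es) = A}"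
    let ?xs = "take (card A) es" and ?ys = "drop (card A) es"
    have "distinct (?xs @ ?ys)" "set (?xs @ ?ys) = S" using es by (simp_all add: permutations_of_set_def)
    moreover have "set ?xs = A" using es by simp
    ultimately have "(?xs, ?ys) \<in> ?P"
      unfolding permutations_of_set_def set_append distinct_append by auto
    moreover have "es = ?xs @ ?ys" by simp
    ultimately show "es \<in> (\<lambda>(xs, ys). xs @ ys) ` ?P" by (metis (no_types, lifting) case_prod_conv image_eqI)
  next
    fix es assume "es \<in> (\<lambda>(xs, ys). xs @ ys) ` ?P"
    then obtain xs ys where "es = xs @ ys" "xs \<in> permutations_of_set A" "ys \<in> permutations_of_set (S - A)"
      by auto
    moreover from this have "length xs = card A" by (simp add: length_finite_permutations_of_set)
    ultimately show "es \<in> {es \<in> permutations_of_set S. set (take (card A) es) = A}"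
      using A by (auto simp: permutations_of_set_def)
  qed
  moreover have "inj_on (\<lambda>(xs, ys). xs @ ys) ?P"
  proof (rule inj_onI, clarify)
    fix xs ys xs' ys'
    assume "xs \<in> permutations_of_set A" "xs' \<in> permutations_of_set A" "xs @ ys = xs' @ ys'"
    moreover from this have "length xs = length xs'"
      by (simp add: length_finite_permutations_of_set)
    ultimately show "xs = xs' \<and> ys = ys'" by simp
  qed
  moreover have "finite A" using A S finite_subset by blast
  ultimately show ?thesis
    using S by (simp add: card_image card_cartesian_product)
qed

text \<open>The size \<open>k\<close> has probability \<open>(n choose k) / 2 ^ n\<close>, and given
  \<open>k\<close> each set of that size is the prefix set with probability
  \<open>1 / (n choose k)\<close>; the product does not depend on \<open>k\<close>.\<close>

lemma sample_uniform:
  "map_pmf (\<lambda>(k, es). set (take k es)) (arrivals n) = pmf_of_set (Pow {..<n})"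
proof (rule pmf_eqI)
  fix A :: "nat set"
  let ?perms = "permutations_of_set {..<n}"
  let ?f = "\<lambda>k. pmf (map_pmf (\<lambda>es. set (take k es)) (pmf_of_set ?perms)) A"
  have f: "?f k = real (card {es \<in> ?perms. set (take k es) = A}) / fact n" for k
    by (simp add: pmf_map measure_pmf_of_set vimage_def Int_def)
  have "map_pmf (\<lambda>(k, es). set (take k es)) (arrivals n)
      = bind_pmf (binomial_pmf n (1/2)) (\<lambda>k. map_pmf (\<lambda>es. set (take k es)) (pmf_of_set ?perms))"
    by (simp add: arrivals_def pair_pmf_def map_bind_pmf map_pmf_def bind_assoc_pmf bind_return_pmf)
  then have "pmf (map_pmf (\<lambda>(k, es). set (take k es)) (arrivals n)) A
      = measure_pmf.expectation (binomial_pmf n (1/2)) ?f"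
    by (simp add: pmf_bind)
  also have "\<dots> = (\<Sum>k\<le>n. ?f k * pmf (binomial_pmf n (1/2)) k)"
    by (rule integral_measure_pmf_real) auto
  also have "\<dots> = (\<Sum>k\<le>n. if A \<subseteq> {..<n} \<and> k = card A then 1 / 2 ^ n else 0)"
  proof (rule sum.cong)
    fix k assume k: "k \<in> {..n}"
    show "?f k * pmf (binomial_pmf n (1/2)) k = (if A \<subseteq> {..<n} \<and> k = card A then 1 / 2 ^ n else 0)"
    proof (cases "A \<subseteq> {..<n} \<and> k = card A")
      case True
      then have "card {es \<in> ?perms. set (take k es) = A} = fact k * fact (n - k)"
        using card_permutations_with_prefix_set[of "{..<n}" A] True finite_subset[of A "{..<n}"]
        by (simp add: card_Diff_subset)
      moreover have "pmf (binomial_pmf n (1/2)) k = fact n / (fact k * fact (n - k)) / 2 ^ n"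
        using k by (simp add: binomial_fact power_divide flip: power_add)
      ultimately show ?thesis using True by (simp add: f)
    next
      case False
      \<comment> \<open>A prefix of length \<open>k \<le> n\<close> of a permutation has exactly
        \<open>k\<close> elements, all below \<open>n\<close>.\<close>
      have "{es \<in> ?perms. set (take k es) = A} = {}"
      proof (rule ccontr)
        assume "\<not> ?thesis"
        then obtain es where es: "set es = {..<n}" "distinct es" "set (take k es) = A"
          by (auto simp: permutations_of_set_def)
        then have "length es = n" by (metis card_lessThan distinct_card)
        then have "card A = k" using es k distinct_card[of "take k es"] by auto
        moreover have "A \<subseteq> {..<n}" using es set_take_subset by metis
        ultimately show False using False by simp
      qed
      then have "?f k = 0" unfolding f by (simp only: card.empty of_nat_0 div_0)
      then show ?thesis unfolding if_not_P[OF False] by (simp only: mult_zero_left)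
    qed
  qed simp
  also have "\<dots> = pmf (pmf_of_set (Pow {..<n})) A"
  proof (cases "A \<subseteq> {..<n}")
    case True
    then have "card A \<le> n" using card_mono[of "{..<n}" A] by simp
    then show ?thesis
      using True by (subst pmf_of_set) (auto simp: card_Pow)
  next
    case False
    then show ?thesis by (subst pmf_of_set) auto
  qed
  finally show "pmf (map_pmf (\<lambda>(k, es). set (take k es)) (arrivals n)) A = pmf (pmf_of_set (Pow {..<n})) A" .
qed

text \<open>Greedy never falls below its initial profit 0, so samples outside \<open>G\<close> do no
  harm, and the uniform sample hits \<open>G\<close> with probability at least 1/2. As
  \<open>good\<close> holds for every order of the remaining items, no conditioning on that order is
  involved.\<close>

lemma expected_profit_ge:
  assumes inst: "profit_instance d g n v s" and c: "0 \<le> c" and G: "G \<subseteq> Pow {..<n}"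
    and half: "2 ^ n \<le> 2 * real (card G)"
    and good: "\<And>L R. L \<in> G \<Longrightarrow> distinct R \<Longrightarrow> set R = {..<n} - L
       \<Longrightarrow> c \<le> set_profit n v s g (process n v s g (items_strictly_above d v s (set R) (m L)) R)"
  shows "c / 2 \<le> expected_profit d n v s g m"
proof -
  interpret profit_instance d g n v s by (rule inst)
  let ?L = "\<lambda>(k, es). set (take k es)"
  have fin: "finite (set_pmf (arrivals n))"
    by (auto simp: arrivals_def set_pmf_of_set)
  have "c / 2 \<le> c * (real (card G) / 2 ^ n)"
    using half c by (simp add: field_simps mult_left_mono)
  also have "real (card G) / 2 ^ n = measure (pmf_of_set (Pow {..<n})) G"
  proof (subst measure_pmf_of_set)
    show "Pow {..<n} \<noteq> {}" "finite (Pow {..<n})" by auto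
    show "real (card G) / 2 ^ n = real (card (Pow {..<n} \<inter> G)) / real (card (Pow {..<n}))"
      using G by (simp add: card_Pow Int_absorb1)
  qed
  also have "\<dots> = measure (arrivals n) (?L -` G)"
    by (simp flip: sample_uniform)
  also have "c * \<dots> = measure_pmf.expectation (arrivals n) (\<lambda>x. c * indicator (?L -` G) x)"
    by simp
  also have "\<dots> \<le> expected_profit d n v s g m"
    unfolding expected_profit_def
  proof (rule integral_mono_AE)
    show "integrable (measure_pmf (arrivals n)) (\<lambda>x. c * indicator (?L -` G) x)"
      "integrable (measure_pmf (arrivals n)) (\<lambda>(k, es). set_profit n v s g (OA d n v s g m k es))"
      using fin by (auto intro: integrable_measure_pmf_finite)
    show "AE x in measure_pmf (arrivals n). c * indicator (?L -` G) x
        \<le> (case x of (k, es) \<Rightarrow> set_profit n v s g (OA d n v s g m k es))"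
      unfolding AE_measure_pmf_iff
    proof (clarify)
      fix k es assume "(k, es) \<in> set_pmf (arrivals n)"
      then have "es \<in> permutations_of_set {..<n}" by (auto simp: arrivals_def)
      then have es: "distinct es" "set es = {..<n}" by (auto dest: permutations_of_setD)
      then have "distinct (drop k es)" "set (drop k es) = {..<n} - set (take k es)"
        using set_take_disj_set_drop_if_distinct[of es k k] append_take_drop_id[of k es]
        by (auto simp flip: set_append) (metis Un_iff append_take_drop_id lessThan_iff set_append)+
      then have "c \<le> set_profit n v s g (OA d n v s g m k es)" if "set (take k es) \<in> G"
        using good[OF that, of "drop k es"] by (simp add: OA_def Let_def)
      moreover have "0 \<le> set_profit n v s g (OA d n v s g m k es)"
        using profit_le_greedy[of "{}"] by (simp add: OA_def Let_def process_def)
      ultimately show "c * indicator (?L -` G) (k, es) \<le> set_profit n v s g (OA d n v s g m k es)"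
        by (auto simp: indicator_def)
    qed
  qed
  finally show ?thesis .
qed

lemma expected_profit_ge_opt:
  assumes d: "1 \<le> d" and sa: "standing_assumption d n v s g \<eta>"
    and C: "threshold_curve d g \<C>" and m: "threshold_rule d n v s g \<C> m"
  shows "opt n v s g / (800 * real d) \<le> expected_profit d n v s g m"
proof -
  interpret profit_instance d g n v s
    using sa by unfold_locales (auto simp: standing_assumption_def)
  have inst: "profit_instance d g n v s" by unfold_locales
  let ?opt = "opt n v s g"
  have \<eta>: "10 ^ 4 \<le> \<eta>" and gp: "general_position d n v s"
    using sa by (auto simp: standing_assumption_def)
  show ?thesis
  proof (cases "0 < ?opt")
    case False
    then have "?opt = 0" using opt_nonneg by simp
    moreover have "0 \<le> expected_profit d n v s g m"
      using expected_profit_ge[OF inst, of 0 "Pow {..<n}" m] profit_le_greedy[of "{}"]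
      by (simp add: card_Pow process_def)
    ultimately show ?thesis by simp
  next
    case opt: True
    \<comment> \<open>The single-item bound with \<eta> replaced by its least value.\<close>
    define M where "M = ?opt / (10 ^ 4 * real d)"
    have M: "0 < M" using opt d by (simp add: M_def)
    have cap: "\<pi> (only_item e t) \<le> M" if "e < n" "0 \<le> t" "t \<le> 1" for e t
    proof -
      have "\<pi> (only_item e t) \<le> max 0 (\<pi> (indicator {e}))"
        using that sa by (intro profit_only_item_le) (auto simp: standing_assumption_def)
      also have "\<pi> (indicator {e}) \<le> ?opt / (\<eta> * real d)"
        using sa that by (auto simp: standing_assumption_def)
      also have "\<dots> \<le> M"
        unfolding M_def using opt d \<eta> by (intro divide_left_mono mult_right_mono) auto
      finally show ?thesis using M by simp
    qed
    obtain A where A: "A \<subseteq> {..<n}" "\<pi> (indicator A) = ?opt" by (rule opt_witness)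
    have capA: "\<pi> (only_item e (x e)) \<le> M" if "e < n" "x \<in> fractional B" for e x B
      using cap that fractionalD by blast
    obtain a where a: "\<And>e. 0 \<le> a e" "\<And>e. a e \<le> M" "\<pi> (indicator A) \<le> (\<Sum>e<n. a e)"
      "\<And>B. B \<subseteq> {..<n} \<Longrightarrow> (\<Sum>e\<in>B. a e) \<le> fo (B \<inter> A)"
      using additive_lower_bound[OF indicator_in_fractional A(1) less_imp_le[OF M] capA[OF _ indicator_in_fractional]]
      by metis
    let ?U = "\<lambda>\<tau>. items_above d v s {..<n} (curve_point d g \<tau>)"
    have "?opt / (48 * real d) \<le> ?opt / 1" using opt d by (intro divide_left_mono) auto
    then have "?opt / (48 * real d) \<le> fo {..<n}" using opt_le_fopt by simp
    then obtain W where W: "W \<subseteq> {..<n}" "?opt / (48 * real d) \<le> fo W"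
      "\<And>\<tau>. 0 < \<tau> \<Longrightarrow> ?opt / (48 * real d) \<le> fo (?U \<tau>) \<Longrightarrow> W \<subseteq> ?U \<tau>"
      by (rule common_core) blast
    \<comment> \<open>Strictly below \<open>opt / (48 * d)\<close>, so that an actual vector
      \<open>x\<close> witnesses it, and with \<open>F / 4\<close> equal to the
      \<open>opt / (200 * d)\<close> required by \<open>greedy_profit\<close>.\<close>
    define F where "F = ?opt / (50 * real d)"
    have F: "0 < F" using opt d by (simp add: F_def)
    have "F < ?opt / (48 * real d)" unfolding F_def using opt d by (intro divide_strict_left_mono) auto
    with W(2) have "F < fo W" by linarith
    then obtain x where x: "x \<in> fractional W" "F < \<pi> x" by (rule fopt_witness)
    obtain a' where a': "\<And>e. 0 \<le> a' e" "\<And>e. a' e \<le> M" "\<pi> x \<le> (\<Sum>e<n. a' e)"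
      "\<And>B. B \<subseteq> {..<n} \<Longrightarrow> (\<Sum>e\<in>B. a' e) \<le> fo (B \<inter> W)"
      using additive_lower_bound[OF x(1) W(1) less_imp_le[OF M] capA[OF _ x(1)]]
      by metis
    define bad where "bad c h = {L \<in> Pow {..<n}. sum h L < c / 4 \<or> sum h ({..<n} - L) < c / 4}"
      for c and h :: "nat \<Rightarrow> real"
    have "?opt * real (card (bad ?opt a)) \<le> 4 * M * 2 ^ n"
      using card_unbalanced_subsets[of "{..<n}" a M ?opt] a A opt by (simp add: bad_def)
    also have "4 * M * 2 ^ n \<le> ?opt / 4 * 2 ^ n"
      using opt d by (intro mult_right_mono) (simp_all add: M_def field_simps)
    finally have bad1: "real (card (bad ?opt a)) \<le> 2 ^ n / 4" using opt by simp
    have "F * real (card (bad F a')) \<le> 4 * M * 2 ^ n"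
      using card_unbalanced_subsets[of "{..<n}" a' M F] a' x F by (simp add: bad_def)
    \<comment> \<open>Here \<open>d\<close> cancels and \<open>4 * M / F\<close> is 1/50: the core
      carries only order \<open>opt / d\<close>, which is why single items must be bounded on that
      scale too.\<close>
    also have "4 * M * 2 ^ n \<le> F / 4 * 2 ^ n"
      using opt d by (intro mult_right_mono) (simp_all add: M_def F_def field_simps)
    finally have bad2: "real (card (bad F a')) \<le> 2 ^ n / 4" using F by simp
    define G where "G = Pow {..<n} - (bad ?opt a \<union> bad F a')"
    have "finite (G \<union> (bad ?opt a \<union> bad F a'))" by (simp add: G_def bad_def)
    then have "card (Pow {..<n}) \<le> card (G \<union> (bad ?opt a \<union> bad F a'))"
      by (rule card_mono) (auto simp: G_def)
    also have "\<dots> \<le> card G + card (bad ?opt a \<union> bad F a')" by (rule card_Un_le)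
    also have "card (bad ?opt a \<union> bad F a') \<le> card (bad ?opt a) + card (bad F a')" by (rule card_Un_le)
    finally have "real (2 ^ n) \<le> real (card G + (card (bad ?opt a) + card (bad F a')))"
      by (simp only: of_nat_le_iff card_Pow[OF finite_lessThan] card_lessThan)
    \<comment> \<open>Each of the two bad families takes at most a quarter of all subsets.\<close>
    then have half: "2 ^ n \<le> 2 * real (card G)" using bad1 bad2 by simp
    have "?opt / (400 * real d) / 2 \<le> expected_profit d n v s g m"
    proof (rule expected_profit_ge[OF inst _ _ half])
      fix L R assume L: "L \<in> G" and R: "distinct R" "set R = {..<n} - L"
      have Ln: "L \<subseteq> {..<n}" and good: "?opt / 4 \<le> sum a L" "F / 4 \<le> sum a' ({..<n} - L)"
        using L by (auto simp: G_def bad_def)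
      have "?opt / 4 \<le> fo L"
        using good(1) a(4)[OF Ln] fopt_mono[of "L \<inter> A" L] by simp
      moreover have "?opt / (200 * real d) \<le> fo (set R \<inter> W)"
        using good(2) a'(4)[of "{..<n} - L"] R by (simp add: F_def)
      ultimately show "?opt / (400 * real d)
          \<le> \<pi> (indicator (process n v s g (items_strictly_above d v s (set R) (m L)) R))"
        unfolding process_def
        using greedy_profit[OF d C m gp Ln R opt _ cap[unfolded M_def] W(3)] by blast
    qed (use opt in \<open>auto simp: G_def\<close>)
    then show ?thesis by simp
  qed
qed

theorem mainTheorem4:
  shows "\<exists>C::real. C > 0 \<and>
    (\<forall>(d::nat) (n::nat) (v::nat \<Rightarrow> real) (s::nat \<Rightarrow> rvec) (g::rvec \<Rightarrow> real) (\<eta>::real)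
       (\<C>::rvec set) (m::nat set \<Rightarrow> rvec).
       d \<ge> 1 \<longrightarrow>
       standing_assumption d n v s g \<eta> \<longrightarrow>
       threshold_curve d g \<C> \<longrightarrow>
       threshold_rule d n v s g \<C> m \<longrightarrow>
       expected_profit d n v s g m \<ge> opt n v s g / (C * real d))"
  \<comment> \<open>800 is the 400 of \<open>greedy_profit\<close>, doubled by the probability 1/2
    of a good sample.\<close>
  by (rule exI[of _ 800]) (use expected_profit_ge_opt in auto)

end
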